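(* Let $a<b$ be positive integers and let $\lambda$ be a partition such that $\lambda^{\mathrm{Cr}_{a,b}}$ is a partition. Suppose that every box $(i,j)\in\lambda$ whose hook length $H_{i,j}$ is divisible by $b$ satisfies $$\left(\frac{b}{a}-1\right)l_{i,j} < a_{i,j}+1 .$$ Then $\lambda$ is $b$-regular and $\lambda^{\mathrm{M}_b\mathrm{Tr}}=\lambda^{\mathrm{Cr}_{a,b}}$.
   Context: A partition $\lambda=(\lambda_1\ge\lambda_2\ge\dots\ge\lambda_k>0)$ (with $\lambda_i=0$ for $i>k$, $l(\lambda)=k$, $|\lambda|=\sum\lambda_i$) is identified with its Young diagram $\{(i,j)\in\mathbb{Z}_{>0}^2: j\le\lambda_i\}$ (English convention: $i$ is the row index increasing southwards, $j$ the column index increasing eastwards). $\lambda^{\mathrm{Tr}}$ is the transpose (conjugate) partition. For $(i,j)\in\lambda$: arm $a_{i,j}=\lambda_i-j$, leg $l_{i,j}=\lambda^{\mathrm{Tr}}_j-i$, hook length $H_{i,j}=1+a_{i,j}+l_{i,j}$. $\lambda$ is $b$-regular if there is no $i$ with $\lambda_i=\lambda_{i+1}=\dots=\lambda_{i+b-1}>0$. Ladders and column regularization: for $(x,y)\in\mathbb{Z}^2$, the ladder $\ell_{x,y}=\{(i,j)\in\mathbb{Z}_{>0}^2:\exists t\in\mathbb{Z},\ i=x-ta,\ j=y+t(b-a)\}$. The distinct ladders partition $\mathbb{Z}_{>0}^2$ into finite sets. $\lambda^{\mathrm{Cr}_{a,b}}$ is the set obtained by replacing, for each ladder $\ell$,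 the set $\lambda\cap\ell$ by the $|\lambda\cap\ell|$ points of $\ell$ with the largest first coordinates (i.e. sliding the boxes southwards along the ladder to the bottom); it need not be a partition. Rim and $b$-rim (for $b$-regular $\lambda$): the rim is $\{(i,j)\in\lambda:(i+1,j+1)\notin\lambda\}$, a connected path of boxes traversed from $(1,\lambda_1)$ southwestwards to $(l(\lambda),1)$. The $b$-rim is the union of pieces chosen as follows: the first piece consists of $b$ consecutive rim boxes starting at $(1,\lambda_1)$ moving southwestwards along the rim; if the last box of a piece lies in row $i_0$, the next piece consists of $b$ consecutive rim boxes starting at the rightmost box $(i_0+1,\lambda_{i_0+1})$ of row $i_0+1$; continue until reaching the last row (the final piece may have fewer than $b$ boxes). Let $\lambda^{\mathrm{I}_b}=(\mu_1,\dots,\mu_k)$ (trailing zeros allowed) be $\lambda$ with its $b$-rim removed, $\phi=|\lambda|-|\lambda^{\mathrm{I}_b}|$, and define $\lambda^{\mathrm{J}_b}=(\mu_1+1,\dots,\mu_{k-1}+1,\mu_k+\delta)$ where $\delta=1$ if $b\mid\phi$ and $\delta=0$ otherwise. For $b$-regular $\lambda$, $\lambda^{\mathrm{M}_b\mathrm{Tr}}=(j_1,\dots,j_l)$ where $j_i=|\lambda^{\mathrm{J}_b^{i-1}}|-|\lambda^{\mathrm{J}_b^{i}}|$ (iterating $\mathrm{J}_b$ until the empty partition is reached); this is the composition of the Mullineux map $\mathrm{M}_b$ with transposition. *)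

theory Defs
  imports Complex_Main
begin

text \<open>
  A partition is the list of its positive parts in weakly decreasing order. Rows and columns
  of Young diagrams are numbered from 1, the row index coming first (English convention).
\<close>

definition is_partition :: "nat list \<Rightarrow> bool" where
  "is_partition \<nu> \<longleftrightarrow> sorted_wrt (\<ge>) \<nu> \<and> (\<forall>x\<in>set \<nu>. 0 < x)"

definition part :: "nat list \<Rightarrow> nat \<Rightarrow> nat" where
  "part \<nu> i = (if 1 \<le> i \<and> i \<le> length \<nu> then \<nu> ! (i - 1) else 0)"

definition young_diagram :: "nat list \<Rightarrow> (nat \<times> nat) set" where
  "young_diagram \<nu> = {(i, j). 1 \<le> i \<and> 1 \<le> j \<and> j \<le> part \<nu> i}"

definition conjugate :: "nat list \<Rightarrow> nat list" where
  "conjugate \<nu> = map (\<lambda>j. card {i. (i, j) \<in> young_diagram \<nu>}) [1..<Suc (part \<nu> 1)]"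

text \<open>The truncated subtractions below are exact for boxes of the diagram.\<close>

definition arm :: "nat list \<Rightarrow> nat \<Rightarrow> nat \<Rightarrow> nat" where
  "arm \<nu> i j = part \<nu> i - j"

definition leg :: "nat list \<Rightarrow> nat \<Rightarrow> nat \<Rightarrow> nat" where
  "leg \<nu> i j = part (conjugate \<nu>) j - i"

definition hook :: "nat list \<Rightarrow> nat \<Rightarrow> nat \<Rightarrow> nat" where
  "hook \<nu> i j = 1 + arm \<nu> i j + leg \<nu> i j"

definition regular :: "nat \<Rightarrow> nat list \<Rightarrow> bool" where
  "regular b \<nu> \<longleftrightarrow> \<not> (\<exists>i\<ge>1. 0 < part \<nu> i \<and> (\<forall>t<b. part \<nu> (i + t) = part \<nu> i))"


definition ladder :: "nat \<Rightarrow> nat \<Rightarrow> int \<Rightarrow> int \<Rightarrow> (nat \<times> nat) set" where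
  "ladder a b x y = {(i, j). 0 < i \<and> 0 < j \<and>
     (\<exists>t::int. int i = x - t * int a \<and> int j = y + t * (int b - int a))}"

text \<open>
  The \<open>n\<close> points of \<open>S\<close> with the largest first coordinates, for finite \<open>S\<close> whose points have
  distinct first coordinates (as ladders do when \<open>0 < a < b\<close>).
\<close>

definition lowest :: "nat \<Rightarrow> (nat \<times> nat) set \<Rightarrow> (nat \<times> nat) set" where
  "lowest n S = {p \<in> S. card {q \<in> S. fst p < fst q} < n}"

definition column_regularization :: "nat \<Rightarrow> nat \<Rightarrow> nat list \<Rightarrow> (nat \<times> nat) set" where
  "column_regularization a b \<nu> =
     (\<Union>x y. lowest (card (young_diagram \<nu> \<inter> ladder a b x y)) (ladder a b x y))"


definition rim :: "nat list \<Rightarrow> (nat \<times> nat) set" where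
  "rim \<nu> = {(i, j) \<in> young_diagram \<nu>. (i + 1, j + 1) \<notin> young_diagram \<nu>}"

text \<open>
  One step southwestwards along the rim. From the last rim box, in column 1 of the last row,
  the step leads to column 0, outside the rim.
\<close>

definition rim_step :: "nat list \<Rightarrow> nat \<times> nat \<Rightarrow> nat \<times> nat" where
  "rim_step \<nu> = (\<lambda>(i, j). if (i + 1, j) \<in> young_diagram \<nu> then (i + 1, j) else (i, j - 1))"

text \<open>
  The piece of the \<open>b\<close>-rim that starts at the end of row \<open>i\<close>, in order of traversal; it has
  fewer than \<open>b\<close> boxes only if the rim ends before.
\<close>

definition rim_piece :: "nat \<Rightarrow> nat list \<Rightarrow> nat \<Rightarrow> (nat \<times> nat) list" where
  "rim_piece b \<nu> i =
     takeWhile (\<lambda>p. p \<in> rim \<nu>) (map (\<lambda>t. (rim_step \<nu> ^^ t) (i, part \<nu> i)) [0..<b])"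

inductive_set piece_rows :: "nat \<Rightarrow> nat list \<Rightarrow> nat set" for b \<nu> where
  first: "\<nu> \<noteq> [] \<Longrightarrow> 1 \<in> piece_rows b \<nu>"
| step: "i \<in> piece_rows b \<nu> \<Longrightarrow> fst (last (rim_piece b \<nu> i)) + 1 \<le> length \<nu> \<Longrightarrow>
    fst (last (rim_piece b \<nu> i)) + 1 \<in> piece_rows b \<nu>"

definition b_rim :: "nat \<Rightarrow> nat list \<Rightarrow> (nat \<times> nat) set" where
  "b_rim b \<nu> = (\<Union>i\<in>piece_rows b \<nu>. set (rim_piece b \<nu> i))"

text \<open>Row lengths after removal of the \<open>b\<close>-rim, trailing zeros included.\<close>

definition remove_b_rim :: "nat \<Rightarrow> nat list \<Rightarrow> nat list" where
  "remove_b_rim b \<nu> =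
     map (\<lambda>i. card {j. (i, j) \<in> young_diagram \<nu> - b_rim b \<nu>}) [1..<Suc (length \<nu>)]"

text \<open>Only the last entry can be zero; the filter then drops it.\<close>

definition J_map :: "nat \<Rightarrow> nat list \<Rightarrow> nat list" where
  "J_map b \<nu> = (if \<nu> = [] then [] else
     let \<mu> = remove_b_rim b \<nu>;
         \<phi> = sum_list \<nu> - sum_list \<mu>;
         \<delta> = (if b dvd \<phi> then 1 else 0)
     in filter (\<lambda>x. 0 < x) (map (\<lambda>x. x + 1) (butlast \<mu>) @ [last \<mu> + \<delta>]))"

text \<open>
  The Mullineux map followed by transposition, meaningful for \<open>b\<close>-regular partitions
  with \<open>b \<ge> 2\<close>, on which iterating \<open>J_map b\<close> reaches the empty partition.
\<close>

definition mullineux_transpose :: "nat \<Rightarrow> nat list \<Rightarrow> nat list" where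
  "mullineux_transpose b \<nu> =
     map (\<lambda>i. sum_list ((J_map b ^^ i) \<nu>) - sum_list ((J_map b ^^ Suc i) \<nu>))
       [0..<(LEAST l. (J_map b ^^ l) \<nu> = [])]"

end

theory Submission
  imports Defs
begin

text \<open>
  Let \<open>(D s, D s - s)\<close> be the point where the boundary of \<open>\<nu>\<close>, traversed from the north-east to the
  south-west, crosses the diagonal \<open>i - j = s\<close>. A box \<open>(i, j)\<close> belongs to \<open>\<nu>\<close>
  iff \<open>i \<le> D (i - j)\<close>. The hook condition says that \<open>D (s + m b) - D s \<le> m a\<close> whenever the step at \<open>s\<close>
  goes south and the step at \<open>s + m b\<close> goes west. The pieces of the \<open>b\<close>-rim correspond to intervals
  \<open>[\<sigma> p, \<sigma> p + b)\<close>, where \<open>\<sigma> (p + 1)\<close> is the first south step from \<open>\<sigma> p + b\<close> on, and the map \<open>J\<close> replaces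
  \<open>D s\<close> by \<open>D (s + 1)\<close>, minus 1 if \<open>s\<close> is covered by these intervals.

  If the regularization is a partition, then the depth at every gap after \<open>p\<close> pieces is exactly \<open>p a\<close>.
  Hence the gaps correspond bijectively to the boxes of the first row whose ladder leaves \<open>\<nu>\<close>, so
  \<open>J\<close> deletes the first row of the regularization; it also preserves the hook condition. Since
  regularization preserves the number of boxes, the theorem follows by induction on the rows.
\<close>

section \<open>Greedy decomposition of a lattice path\<close>

text \<open>Models the boundary of a partition cut into the pieces of the \<open>b\<close>-rim. The
  sequence \<open>\<sigma>\<close> is infinite because below the last row every boundary step goes
  south; the pieces found there contain no boxes.\<close>

locale greedy_path =
  fixes D :: "int \<Rightarrow> int" and b :: int and \<sigma> :: "nat \<Rightarrow> int"
  assumes b_pos: "0 < b"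
    and nonneg: "\<And>s. 0 \<le> D s"
    and step: "\<And>s. D (s + 1) = D s \<or> D (s + 1) = D s + 1"
    and start: "D (\<sigma> 0) = 0"
    and south: "\<And>p. D (\<sigma> p + 1) = D (\<sigma> p) + 1"
    and spaced: "\<And>p. \<sigma> p + b \<le> \<sigma> (Suc p)"
    and gap: "\<And>p s. \<sigma> p + b \<le> s \<Longrightarrow> s < \<sigma> (Suc p) \<Longrightarrow> D (s + 1) = D s"
begin

definition covered :: "int set" where
  "covered = {s. \<exists>p. \<sigma> p \<le> s \<and> s < \<sigma> p + b}"

text \<open>Offset of piece \<open>p\<close> against equally spaced pieces. It grows exactly across
  the nonempty gaps, and \<open>\<sigma> p\<close> is the point of index \<open>p\<close> in the
  progression \<open>\<tau> p + n * b\<close>.\<close>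

definition \<tau> :: "nat \<Rightarrow> int" where
  "\<tau> p = \<sigma> p - int p * b"

text \<open>The depth function of the partition after one application of \<open>J\<close>.\<close>

definition E :: "int \<Rightarrow> int" where
  "E s = D (s + 1) - (if s \<in> covered then 1 else 0)"

lemma \<sigma>_eq: "\<sigma> p = \<tau> p + int p * b"
  by (simp add: \<tau>_def)

lemma \<tau>_Suc: "\<tau> p \<le> \<tau> (Suc p)"
  using spaced[of p] by (simp add: \<tau>_def algebra_simps)

lemma \<tau>_mono: "p \<le> q \<Longrightarrow> \<tau> p \<le> \<tau> q"
  by (rule lift_Suc_mono_le[of \<tau>]) (auto intro: \<tau>_Suc)

lemma D_mono: "s \<le> t \<Longrightarrow> D s \<le> D t"
proof (induction t rule: int_ge_induct)
  case (step t)
  then show ?case using greedy_path.step[OF greedy_path_axioms, of t] by linarith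
qed simp

lemma depth_after_start: "\<tau> m \<le> w \<Longrightarrow> D (\<sigma> m) + 1 \<le> D (w + int m * b + 1)"
  using D_mono[of "\<sigma> m + 1" "w + int m * b + 1"] south[of m] by (simp add: \<sigma>_eq)

lemma depth_beyond_start: "\<tau> m < w \<Longrightarrow> D (\<sigma> m) + 1 \<le> D (w + int m * b)"
  using depth_after_start[of m "w - 1"] by (simp add: algebra_simps)

lemma pos_iff: "1 \<le> D (w + 1) \<longleftrightarrow> \<sigma> 0 \<le> w"
  using D_mono[of "w + 1" "\<sigma> 0"] D_mono[of "\<sigma> 0 + 1" "w + 1"] start south[of 0]
  by (cases "\<sigma> 0 \<le> w") auto

lemma gap_constant:
  assumes "\<sigma> p + b \<le> s" and "s \<le> \<sigma> (Suc p)"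
  shows "D s = D (\<sigma> p + b)"
  using assms
proof (induction s rule: int_ge_induct)
  case (step s)
  then show ?case using gap[of p s] by simp
qed simp

text \<open>A group is a maximal run of pieces without gaps, that is, with equal
  \<open>\<tau>\<close>. Its first piece \<open>g\<close> is piece 0 or follows a gap, and there the
  depth will be known exactly.\<close>

lemma first_of_group:
  obtains g where "g \<le> q" "\<tau> g = \<tau> q" "\<And>m. m < g \<Longrightarrow> \<tau> m < \<tau> q"
    "\<And>m. g \<le> m \<Longrightarrow> m \<le> q \<Longrightarrow> \<tau> m = \<tau> q"
proof -
  define g where "g = (LEAST g. \<tau> g = \<tau> q)"
  have g: "\<tau> g = \<tau> q" "g \<le> q"
    unfolding g_def by (rule LeastI[of _ q], simp, rule Least_le, simp)
  have "\<tau> m < \<tau> q" if "m < g" for m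
    using not_less_Least[of m "\<lambda>g. \<tau> g = \<tau> q"] that \<tau>_mono[of m q] g by (fastforce simp: g_def)
  moreover have "\<tau> m = \<tau> q" if "g \<le> m" "m \<le> q" for m
    using \<tau>_mono[OF that(1)] \<tau>_mono[OF that(2)] g by simp
  ultimately show ?thesis using that g by blast
qed

lemma gap_not_covered:
  assumes "\<sigma> q + b \<le> s" and "s < \<sigma> (Suc q)"
  shows "s \<notin> covered"
proof
  assume "s \<in> covered"
  then obtain p where p: "\<sigma> p \<le> s" "s < \<sigma> p + b" by (auto simp: covered_def)
  have mono: "\<sigma> i \<le> \<sigma> j" if "i \<le> j" for i j
    by (rule lift_Suc_mono_le[of \<sigma>, OF _ that]) (use spaced b_pos in \<open>smt (verit)\<close>)
  show False using mono[of p q] mono[of "Suc q" p] p assms by (cases "p \<le> q") auto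
qed

lemma not_covered_cases:
  assumes "s \<notin> covered"
  obtains "s < \<sigma> 0" | q where "\<sigma> q + b \<le> s" "s < \<sigma> (Suc q)"
proof -
  have "\<sigma> 0 + int p \<le> \<sigma> p" for p
  proof (induction p)
    case (Suc p)
    then show ?case using spaced[of p] b_pos by simp
  qed simp
  from this[of "nat (s - \<sigma> 0 + 1)"] have ex: "\<exists>p. s < \<sigma> p" by (intro exI[of _ "nat (s - \<sigma> 0 + 1)"]) linarith
  define p where "p = (LEAST p. s < \<sigma> p)"
  have p: "s < \<sigma> p" unfolding p_def using ex by (rule LeastI_ex)
  show ?thesis
  proof (cases p)
    case 0
    then show ?thesis using p that by simp
  next
    case (Suc q)
    then have "\<sigma> q \<le> s" using not_less_Least[of q "\<lambda>p. s < \<sigma> p"] by (simp add: p_def)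
    then have "\<sigma> q + b \<le> s" using assms by (force simp: covered_def)
    then show ?thesis using that(2)[of q] p Suc by simp
  qed
qed

text \<open>Before \<open>\<sigma> 0\<close> the depth is 0, and gaps contain only west steps; hence
  every south step belongs to a piece.\<close>

lemma not_covered_flat:
  assumes "s \<notin> covered"
  shows "D (s + 1) = D s"
  using assms
proof (cases rule: not_covered_cases)
  case 1
  then show ?thesis using pos_iff[of s] step[of s] nonneg[of s] by auto
qed (use gap in auto)

end

text \<open>The assumption \<open>ladders\<close> concerns the ladder of the box
  \<open>(1, -w)\<close>, whose point of index \<open>t\<close> is missing iff
  \<open>D (w + t * b + 1) \<le> t * a\<close>. If this ladder starts in the partition and leaves
  it, some missing point lies directly below the last box of a column.\<close>

locale hook_path = greedy_path +
  fixes a :: int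
  assumes a_pos: "0 < a" and a_less_b: "a < b"
    and hooks: "\<And>s m. 0 < m \<Longrightarrow> D (s + 1) = D s + 1 \<Longrightarrow> D (s + m * b + 1) = D (s + m * b) \<Longrightarrow>
                  D (s + m * b) \<le> D s + m * a"
    and ladders: "\<And>w m. 1 \<le> D (w + 1) \<Longrightarrow> 0 \<le> m \<Longrightarrow> D (w + m * b + 1) \<le> m * a \<Longrightarrow>
                  \<exists>n\<ge>0. D (w + n * b) = n * a \<and> D (w + n * b + 1) = n * a"
begin

text \<open>Strong induction over the pieces that follow a gap. The hook condition, applied from the
  first piece of the preceding group, bounds the depth above by \<open>p * a\<close>. A smaller
  depth is refuted by the two ladders \<open>w = \<tau> q\<close> and \<open>w = \<tau> p\<close> on
  either side of the gap.\<close>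

lemma depth_at_gap_end:
  assumes "p = 0 \<or> \<tau> (p - 1) < \<tau> p"
  shows "D (\<sigma> p) = int p * a \<and> (\<forall>m<p. int m * a \<le> D (\<sigma> m))"
  using assms
proof (induction p rule: less_induct)
  case (less p)
  show ?case
  proof (cases p)
    case 0
    then show ?thesis using start by simp
  next
    case (Suc q)
    then have lt: "\<tau> q < \<tau> p" using less.prems by simp
    obtain g where g: "g \<le> q" "\<tau> g = \<tau> q" "\<And>m. m < g \<Longrightarrow> \<tau> m < \<tau> q"
        "\<And>m. g \<le> m \<Longrightarrow> m \<le> q \<Longrightarrow> \<tau> m = \<tau> q"
      by (rule first_of_group[of q]) blast
    have "g = 0 \<or> \<tau> (g - 1) < \<tau> g" using g(2) g(3)[of "g - 1"] by (cases g) auto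
    then have IH: "D (\<sigma> g) = int g * a" "\<And>m. m < g \<Longrightarrow> int m * a \<le> D (\<sigma> m)"
      using less.IH[of g] g(1) Suc by auto
    have \<sigma>_group: "\<sigma> m = \<tau> q + int m * b" if "g \<le> m" "m \<le> q" for m
      using g(4)[OF that] by (simp add: \<sigma>_eq)
    \<comment> \<open>The first point of the gap. It continues the progression of the starts in the
      group of \<open>q\<close>, so the hook condition compares each of them with it.\<close>
    define z where "z = \<tau> q + int p * b"
    have z: "z = \<sigma> q + b" by (simp add: z_def \<sigma>_eq Suc algebra_simps)
    have z_less: "z < \<sigma> p" using lt by (simp add: z_def \<sigma>_eq)
    have flat: "D (z + 1) = D z" using gap[of q z] z z_less Suc by simp
    have D_end: "D (\<sigma> p) = D z" using gap_constant[of q "\<sigma> p"] z z_less Suc by simp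
    have hook: "D (\<tau> q + int n * b) \<le> D (\<sigma> m) + (int n - int m) * a"
      if "g \<le> m" "m \<le> q" "q < n" "D (\<tau> q + int n * b + 1) = D (\<tau> q + int n * b)" for m n
    proof -
      have "\<sigma> m + (int n - int m) * b = \<tau> q + int n * b"
        using \<sigma>_group[OF that(1,2)] by (simp add: algebra_simps)
      then show ?thesis using hooks[of "int n - int m" "\<sigma> m"] south[of m] that by simp
    qed
    have le: "D z \<le> int p * a"
      using hook[of g p] g(1) flat IH(1) Suc unfolding z_def by (simp add: algebra_simps)
    have pos: "1 \<le> D (\<tau> q + 1)" "1 \<le> D (\<tau> p + 1)"
      unfolding pos_iff using \<tau>_mono[of 0 q] \<tau>_mono[of 0 p] by (auto simp: \<tau>_def)
    have eq: "D z = int p * a"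
    proof (rule ccontr)
      assume "D z \<noteq> int p * a"
      then have less: "D z < int p * a" using le by simp
      \<comment> \<open>Too small a depth makes point \<open>p\<close> of this ladder missing. For
        \<open>n < g\<close> the path is too deep, and for \<open>g \<le> n \<le> q\<close> it goes
        south, so the west step provided by \<open>ladders\<close> lies beyond the gap; hooks ending
        there yield \<open>ge\<close>.\<close>
      obtain n where n: "D (\<tau> q + int n * b) = int n * a" "D (\<tau> q + int n * b + 1) = int n * a"
        using ladders[OF pos(1), of "int p"] flat le unfolding z_def by (metis of_nat_0_le_iff zero_le_imp_eq_int)
      have "\<not> n < g"
      proof
        assume "n < g"
        then show False using depth_beyond_start[OF g(3)[of n]] IH(2)[of n] n by simp
      qed
      moreover have "\<not> (g \<le> n \<and> n \<le> q)" using \<sigma>_group[of n] south[of n] n by auto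
      moreover have "n \<noteq> p" using n less unfolding z_def by auto
      ultimately have "q < n" by simp
      have ge: "int m * a \<le> D (\<sigma> m)" if "m \<le> q" for m
      proof (cases "m < g")
        case False
        then show ?thesis using hook[of m n] n \<open>q < n\<close> that by (simp add: algebra_simps)
      qed (use IH in auto)
      \<comment> \<open>Now the ladder on the other side of the gap, with \<open>\<sigma> p\<close>
        as its point of index \<open>p\<close>. Wherever \<open>ladders\<close> places the west
        step, a contradiction follows.\<close>
      have "D (\<tau> p + int p * b + 1) \<le> int p * a"
        using south[of p] D_end less by (simp add: \<sigma>_eq)
      then obtain k where k: "D (\<tau> p + int k * b) = int k * a" "D (\<tau> p + int k * b + 1) = int k * a"
        using ladders[OF pos(2), of "int p"] by (metis of_nat_0_le_iff zero_le_imp_eq_int)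
      consider "k \<le> q" | "k = p" | "p < k" using Suc by linarith
      then show False
      proof cases
        case 1
        then have "\<tau> k < \<tau> p" using \<tau>_mono[of k q] lt by simp
        then show ?thesis using depth_beyond_start[of k "\<tau> p"] ge[OF 1] k by simp
      next
        case 2
        then show ?thesis using k south[of p] by (simp add: \<sigma>_eq)
      next
        case 3
        have "\<sigma> p + (int k - int p) * b = \<tau> p + int k * b" by (simp add: \<sigma>_eq algebra_simps)
        then have "int k * a \<le> D (\<sigma> p) + (int k - int p) * a"
          using hooks[of "int k - int p" "\<sigma> p"] 3 south[of p] k by simp
        then show ?thesis using D_end less by (simp add: algebra_simps)
      qed
    qed
    have "int m * a \<le> D (\<sigma> m)" if "m < p" for m
    proof (cases "m < g")
      case False
      then show ?thesis using hook[of m p] flat eq that Suc unfolding z_def by (simp add: algebra_simps)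
    qed (use IH in auto)
    then show ?thesis using eq D_end by simp
  qed
qed

text \<open>A later gap reduces this to \<open>depth_at_gap_end\<close>. If no gap follows, the
  group of \<open>m\<close> is infinite, and too small a depth would give a west step on the ladder
  \<open>w = \<tau> m\<close>, whose points from the group on are all starts of pieces.\<close>

lemma depth_at_start: "int m * a \<le> D (\<sigma> m)"
proof (cases "\<exists>p>m. \<tau> (p - 1) < \<tau> p")
  case True
  then show ?thesis using depth_at_gap_end by blast
next
  case False
  have const: "\<tau> p = \<tau> m" if "m \<le> p" for p
    using that
  proof (induction p rule: dec_induct)
    case (step p)
    then show ?case using False \<tau>_Suc[of p] by (metis diff_Suc_1 le_imp_less_Suc order_antisym_conv not_le)
  qed simp
  obtain g where g: "g \<le> m" "\<tau> g = \<tau> m" "\<And>n. n < g \<Longrightarrow> \<tau> n < \<tau> m"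
      "\<And>n. g \<le> n \<Longrightarrow> n \<le> m \<Longrightarrow> \<tau> n = \<tau> m"
    by (rule first_of_group[of m]) blast
  have "g = 0 \<or> \<tau> (g - 1) < \<tau> g" using g(2) g(3)[of "g - 1"] by (cases g) auto
  then have below: "int n * a \<le> D (\<sigma> n)" if "n < g" for n
    using depth_at_gap_end[of g] that by simp
  show ?thesis
  proof (rule ccontr)
    assume "\<not> ?thesis"
    then have "D (\<tau> m + int m * b + 1) \<le> int m * a" using south[of m] by (simp add: \<sigma>_eq)
    moreover have "1 \<le> D (\<tau> m + 1)"
      unfolding pos_iff using \<tau>_mono[of 0 m] by (simp add: \<tau>_def)
    ultimately obtain n where n: "D (\<tau> m + int n * b) = int n * a" "D (\<tau> m + int n * b + 1) = int n * a"
      using ladders[of "\<tau> m" "int m"] by (metis of_nat_0_le_iff zero_le_imp_eq_int)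
    show False
    proof (cases "n < g")
      case True
      then show ?thesis using depth_beyond_start[OF g(3)[of n]] below[of n] n by simp
    next
      case False
      then have "\<tau> n = \<tau> m" using g(4)[of n] const[of n] by (meson not_less nat_le_linear)
      then show ?thesis using n south[of n] by (simp add: \<sigma>_eq)
    qed
  qed
qed

lemma depth_in_gap:
  assumes "\<sigma> q + b \<le> s" and "s < \<sigma> (Suc q)"
  shows "D s = (int q + 1) * a" "D (\<sigma> (Suc q)) = (int q + 1) * a"
proof -
  have "\<tau> q < \<tau> (Suc q)" using assms by (simp add: \<tau>_def algebra_simps)
  then show "D (\<sigma> (Suc q)) = (int q + 1) * a"
    using depth_at_gap_end[of "Suc q"] by (simp add: algebra_simps)
  then show "D s = (int q + 1) * a"
    using gap_constant[of q s] gap_constant[of q "\<sigma> (Suc q)"] assms by simp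
qed

text \<open>An uncovered point of positive depth lies in a gap, and its depth tells which one: index
  \<open>n\<close> belongs to the gap after piece \<open>n - 1\<close>. The bounds on
  \<open>w\<close> then determine \<open>n\<close>, so each ladder has at most one such
  point.\<close>

lemma uncovered_on_ladder:
  assumes "w + n * b \<notin> covered" and "D (w + n * b + 1) = n * a" and "0 < n"
  obtains q where "n = int q + 1" "\<tau> q \<le> w" "w < \<tau> (Suc q)"
  using assms(1)
proof (cases rule: not_covered_cases)
  case 1
  then have "n * a \<le> 0" using pos_iff[of "w + n * b"] assms by auto
  then show ?thesis using assms(3) a_pos by (simp add: mult_le_0_iff)
next
  case (2 q)
  have "n * a = (int q + 1) * a"
    using depth_in_gap(1)[OF 2] not_covered_flat[OF assms(1)] assms(2) by simp
  then have "n = int q + 1" using a_pos by simp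
  then show ?thesis using that[of q] 2 by (simp add: \<tau>_def algebra_simps)
qed

lemma uncovered_on_ladder_unique:
  assumes "w + n * b \<notin> covered" "D (w + n * b + 1) = n * a" "0 < n"
    and "w + k * b \<notin> covered" "D (w + k * b + 1) = k * a" "0 < k"
  shows "n = k"
proof -
  obtain q where q: "n = int q + 1" "\<tau> q \<le> w" "w < \<tau> (Suc q)"
    by (rule uncovered_on_ladder[OF assms(1-3)])
  obtain r where r: "k = int r + 1" "\<tau> r \<le> w" "w < \<tau> (Suc r)"
    by (rule uncovered_on_ladder[OF assms(4-6)])
  have "q = r"
    using \<tau>_mono[of "Suc q" r] \<tau>_mono[of "Suc r" q] q r by (metis not_less not_less_eq_eq order_antisym_conv linorder_not_le less_le_trans)
  then show ?thesis using q r by simp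
qed

lemma uncovered_on_ladder_pos:
  assumes "w + n * b \<notin> covered" "D (w + n * b + 1) = n * a" "0 < n"
  shows "1 \<le> D (w + 1)"
proof -
  obtain q where "n = int q + 1" "\<tau> q \<le> w" by (rule uncovered_on_ladder[OF assms])
  then show ?thesis unfolding pos_iff using \<tau>_mono[of 0 q] by (simp add: \<tau>_def)
qed

lemma uncovered_on_ladder_exists:
  assumes "1 \<le> D (w + 1)" and "0 \<le> m" and "D (w + m * b + 1) \<le> m * a"
  obtains n where "0 < n" "w + n * b \<notin> covered" "D (w + n * b + 1) = n * a"
proof -
  \<comment> \<open>Otherwise \<open>\<sigma> m\<close> lies at or before \<open>w + m * b\<close>,
    and the depth after that step exceeds \<open>m * a\<close>. The least such \<open>p\<close>
    names the gap, just before piece \<open>p\<close>, that contains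
    \<open>w + p * b\<close>.\<close>
  have "\<exists>p. w < \<tau> p"
  proof (rule ccontr)
    assume "\<not> ?thesis"
    then have "\<tau> (nat m) \<le> w" by (simp add: not_less)
    then show False using depth_after_start[of "nat m" w] depth_at_start[of "nat m"] assms by simp
  qed
  define p where "p = (LEAST p. w < \<tau> p)"
  have p: "w < \<tau> p" unfolding p_def using \<open>\<exists>p. w < \<tau> p\<close> by (rule LeastI_ex)
  have "p \<noteq> 0"
  proof
    assume "p = 0"
    then show False using p assms(1) unfolding pos_iff by (simp add: \<tau>_def)
  qed
  then obtain q where Suc: "p = Suc q" using not0_implies_Suc by blast
  then have "\<tau> q \<le> w" using not_less_Least[of q "\<lambda>p. w < \<tau> p"] by (simp add: p_def)
  then have q: "\<sigma> q + b \<le> w + (int q + 1) * b" "w + (int q + 1) * b < \<sigma> (Suc q)"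
    using p Suc by (simp_all add: \<tau>_def algebra_simps)
  show ?thesis
    using that[of "int q + 1"] gap_not_covered[OF q] depth_in_gap(1)[OF q] gap[OF q] by simp
qed

text \<open>A south step of \<open>E\<close> at \<open>s\<close> is a south step of \<open>D\<close>
  at \<open>s + 1\<close> or marks the end of a piece before a gap; a west step of \<open>E\<close>
  comes from a west step of \<open>D\<close> or from a gap. Of the four combinations, only the one
  without gaps follows from the hook condition at once; the others use the known depths at gaps and
  starts.\<close>

lemma E_hooks:
  assumes "0 < m" "E (s + 1) = E s + 1" "E (s + m * b + 1) = E (s + m * b)"
  shows "E (s + m * b) \<le> E s + m * a"
proof -
  define x where "x = s + 1"
  define x' where "x' = x + m * b"
  have x': "s + m * b + 1 = x'" by (simp add: x'_def x_def)
  have cov: "t \<in> covered" if "D (t + 1) = D t + 1" for t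
    using not_covered_flat[of t] that by auto
  have s: "s \<in> covered" and x: "D (x + 1) = D x + 1 \<or> x \<notin> covered \<and> D (x + 1) = D x"
    using assms(2) step[of x] cov[of x] unfolding E_def by (auto simp: x_def split: if_splits)
  have alt: "s + m * b \<in> covered \<and> D (x' + 1) = D x' \<or>
      s + m * b \<notin> covered \<and> (D (x' + 1) = D x' \<and> x' \<notin> covered \<or> D (x' + 1) = D x' + 1)"
    using assms(3) step[of x'] cov[of x'] unfolding E_def x' by (auto split: if_splits)
  have E_s: "E s = D x - 1" using s by (simp add: E_def x_def)
  have E_x': "E (s + m * b) = D x' - (if s + m * b \<in> covered then 1 else 0)"
    by (simp add: E_def x')
  have end_gap: "\<exists>q. D x' = (int q + 1) * a \<and> \<sigma> q + b < x'"
    if out: "s + m * b \<notin> covered" "\<sigma> 0 < x'"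
    using out(1)
  proof (cases rule: not_covered_cases)
    case 1
    then show ?thesis using out x' by linarith
  next
    case (2 q)
    have "D x' = (int q + 1) * a"
      using depth_in_gap(1)[OF 2] gap[OF 2] x' by simp
    then show ?thesis using 2 x' by (intro exI[of _ q]) auto
  qed
  have "\<sigma> 0 \<le> s"
  proof -
    obtain p where "\<sigma> p \<le> s" using s by (auto simp: covered_def)
    moreover have "0 \<le> int p * b" using a_pos a_less_b by simp
    then have "\<sigma> 0 \<le> \<sigma> p" using \<tau>_mono[of 0 p] \<sigma>_eq[of p] \<sigma>_eq[of 0] by linarith
    ultimately show ?thesis by simp
  qed
  then have "\<sigma> 0 < x" by (simp add: x_def)
  moreover have "0 < m * b" using assms(1) a_pos a_less_b by simp
  ultimately have x'_gt: "\<sigma> 0 < x'" by (simp add: x'_def)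
  from x show ?thesis
  proof
    assume south_x: "D (x + 1) = D x + 1"
    show ?thesis
    proof (cases "s + m * b \<in> covered")
      case True
      then have "D x' \<le> D x + m * a" using alt hooks[of m x] south_x assms(1) by (simp add: x'_def)
      then show ?thesis using True E_s by (simp add: E_x')
    next
      case False
      then obtain q where q: "D x' = (int q + 1) * a" "\<sigma> q + b < x'"
        using end_gap x'_gt by blast
      \<comment> \<open>Moving back by \<open>m * b\<close> from beyond the start of the gap after
        piece \<open>q\<close> leads to a point past the start of piece \<open>q + 1 - m\<close>, if
        that index is nonnegative.\<close>
      have "(int q + 1 - m) * a + 1 \<le> D x"
      proof (cases "m \<le> int q + 1")
        case True
        define n where "n = nat (int q + 1 - m)"
        have n: "int n = int q + 1 - m" using True by (simp add: n_def)
        have "\<tau> q < x - int n * b"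
          using q(2) by (simp add: \<tau>_def n x'_def algebra_simps)
        moreover have "\<tau> n \<le> \<tau> q" using n assms(1) by (intro \<tau>_mono) linarith
        ultimately show ?thesis
          using depth_beyond_start[of n "x - int n * b"] depth_at_start[of n] by (simp add: n)
      next
        case False
        then have "(int q + 1 - m) * a \<le> (-1) * a" using a_pos by (intro mult_right_mono) auto
        moreover have "0 \<le> D x" using \<open>\<sigma> 0 < x\<close> D_mono[of "\<sigma> 0" x] start by simp
        ultimately show ?thesis using a_pos by linarith
      qed
      then show ?thesis using E_s E_x' False q by (simp add: algebra_simps)
    qed
  next
    assume x: "x \<notin> covered \<and> D (x + 1) = D x"
    obtain p where p: "\<sigma> p \<le> s" "s < \<sigma> p + b" using s by (auto simp: covered_def)
    have not_in: "\<not> (\<sigma> n \<le> x \<and> x < \<sigma> n + b)" for n using x by (auto simp: covered_def)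
    have x_eq: "x = \<sigma> p + b" using p not_in[of p] by (simp add: x_def)
    have "x < \<sigma> (Suc p)" using not_in[of "Suc p"] spaced[of p] b_pos x_eq by linarith
    then have lt: "\<tau> p < \<tau> (Suc p)" by (simp add: x_eq \<tau>_def algebra_simps)
    have D_x: "D x = (int p + 1) * a"
      using depth_in_gap(1)[of p x] \<open>x < \<sigma> (Suc p)\<close> x_eq by simp
    have x'_eq: "x' = \<tau> p + (int p + 1 + m) * b"
      by (simp add: x'_def x_eq \<sigma>_eq algebra_simps)
    show ?thesis
    proof (cases "s + m * b \<in> covered")
      case True
      \<comment> \<open>The hook starts at the first piece of the group, where the depth is exactly
        \<open>g * a\<close>; at \<open>\<sigma> p\<close> only a lower bound is known in
        general.\<close>
      obtain g where g: "g \<le> p" "\<tau> g = \<tau> p" "\<And>n. n < g \<Longrightarrow> \<tau> n < \<tau> p"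
        by (rule first_of_group[of p]) blast
      have "g = 0 \<or> \<tau> (g - 1) < \<tau> g" using g(2) g(3)[of "g - 1"] by (cases g) auto
      then have D_g: "D (\<sigma> g) = int g * a" using depth_at_gap_end by blast
      have "\<sigma> g + (int p + 1 + m - int g) * b = x'"
        using g(2) by (simp add: x'_eq \<sigma>_eq algebra_simps)
      then have "D x' \<le> D (\<sigma> g) + (int p + 1 + m - int g) * a"
        using hooks[of "int p + 1 + m - int g" "\<sigma> g"] alt True g(1) assms(1) south[of g] by simp
      then show ?thesis using E_s E_x' True D_x D_g by (simp add: algebra_simps)
    next
      case False
      then obtain q where q: "D x' = (int q + 1) * a" "\<sigma> q + b < x'"
        using end_gap x'_gt by blast
      \<comment> \<open>The gap after \<open>p\<close> raises all later offsets, so a larger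
        \<open>q\<close> would put the gap after \<open>q\<close> beyond \<open>x'\<close>.
        Strictness pays for the 1 subtracted in \<open>E s\<close>.\<close>
      have "int q + 1 < int p + 1 + m"
      proof (rule ccontr)
        assume "\<not> ?thesis"
        then have "Suc p \<le> q" and le: "(int p + 1 + m) * b \<le> (int q + 1) * b"
          using assms(1) b_pos by (auto intro!: mult_right_mono)
        then have "\<tau> p < \<tau> q" using lt \<tau>_mono[of "Suc p" q] by simp
        then show False using q(2) le x'_eq by (simp add: \<sigma>_eq algebra_simps)
      qed
      then have "(int q + 1) * a \<le> (int p + m) * a" using a_pos by (intro mult_right_mono) auto
      then show ?thesis using E_s E_x' False q D_x a_pos by (simp add: algebra_simps)
    qed
  qed
qed

end

section \<open>The boundary path of a partition\<close>

text \<open>The diagonal of the last box of row \<open>i\<close>. An empty row gets the diagonal of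
  column 0, so that the boundary continues south below the partition.\<close>

definition row_end :: "nat list \<Rightarrow> nat \<Rightarrow> int" where
  "row_end \<nu> i = int i - int (part \<nu> i)"

definition depth :: "nat list \<Rightarrow> int \<Rightarrow> nat" where
  "depth \<nu> s = card {i. 1 \<le> i \<and> row_end \<nu> i \<le> s}"

lemma part_antimono:
  assumes "is_partition \<nu>" "1 \<le> i" "i \<le> j"
  shows "part \<nu> j \<le> part \<nu> i"
  using assms sorted_wrt_iff_nth_less[of "(\<ge>)" \<nu>]
  by (cases "i = j") (auto simp: is_partition_def part_def)

lemma part_pos: "is_partition \<nu> \<Longrightarrow> 1 \<le> i \<Longrightarrow> i \<le> length \<nu> \<Longrightarrow> 1 \<le> part \<nu> i"
  by (fastforce simp: is_partition_def part_def Suc_le_eq)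

lemma part_eq_0: "length \<nu> < i \<Longrightarrow> part \<nu> i = 0"
  by (simp add: part_def)

lemma row_end_strict_mono:
  "is_partition \<nu> \<Longrightarrow> 1 \<le> i \<Longrightarrow> i < j \<Longrightarrow> row_end \<nu> i < row_end \<nu> j"
  using part_antimono[of \<nu> i j] by (simp add: row_end_def)

lemma row_end_mono:
  "is_partition \<nu> \<Longrightarrow> 1 \<le> i \<Longrightarrow> i \<le> j \<Longrightarrow> row_end \<nu> i \<le> row_end \<nu> j"
  using part_antimono[of \<nu> i j] by (simp add: row_end_def)

lemma row_end_less_iff:
  "is_partition \<nu> \<Longrightarrow> 1 \<le> i \<Longrightarrow> 1 \<le> j \<Longrightarrow> row_end \<nu> i < row_end \<nu> j \<longleftrightarrow> i < j"
  using row_end_strict_mono[of \<nu> i j] row_end_mono[of \<nu> j i] by (cases "i < j") auto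

lemma row_end_beyond: "length \<nu> < i \<Longrightarrow> row_end \<nu> i = int i"
  by (simp add: row_end_def part_eq_0)

lemma row_end_within: "is_partition \<nu> \<Longrightarrow> 1 \<le> i \<Longrightarrow> i \<le> length \<nu> \<Longrightarrow> row_end \<nu> i < int i"
  using part_pos[of \<nu> i] by (simp add: row_end_def)

lemma row_end_le: "row_end \<nu> i \<le> int i"
  by (simp add: row_end_def)

text \<open>Row ends increase along the rows, so the rows counted by \<open>depth\<close> form an
  initial segment. This adjunction carries the later conversions between rows and diagonals.\<close>

lemma le_depth_iff:
  assumes "is_partition \<nu>"
  shows "i \<le> depth \<nu> s \<longleftrightarrow> i = 0 \<or> row_end \<nu> i \<le> s"
proof -
  let ?A = "{i. 1 \<le> i \<and> row_end \<nu> i \<le> s}"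
  have "i \<le> nat (s + int (part \<nu> 1))" if "i \<in> ?A" for i
    using that part_antimono[OF assms, of 1 i] by (auto simp: row_end_def)
  then have fin: "finite ?A" by (meson finite_nat_set_iff_bounded_le)
  show ?thesis
  proof (cases "i = 0 \<or> row_end \<nu> i \<le> s")
    case True
    have "row_end \<nu> j \<le> s" if "1 \<le> j" "j \<le> i" for j
      using True row_end_mono[OF assms that] that by simp
    then have "{1..i} \<subseteq> ?A" by auto
    then have "card {1..i} \<le> card ?A" by (rule card_mono[OF fin])
    then show ?thesis using True by (simp add: depth_def)
  next
    case False
    have "j < i" if "row_end \<nu> j \<le> s" for j
      using False row_end_mono[OF assms, of i j] that by (cases "j < i") auto
    then have "?A \<subseteq> {1..<i}" by auto
    then have "card ?A \<le> card {1..<i}" by (rule card_mono[OF finite_atLeastLessThan])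
    then show ?thesis using False unfolding depth_def by auto
  qed
qed

lemma depth_mono: "is_partition \<nu> \<Longrightarrow> s \<le> t \<Longrightarrow> depth \<nu> s \<le> depth \<nu> t"
  using le_depth_iff[of \<nu> "depth \<nu> s"] by (metis order_refl order_trans)

lemma depth_step:
  assumes "is_partition \<nu>"
  shows "depth \<nu> (s + 1) = depth \<nu> s \<or> depth \<nu> (s + 1) = depth \<nu> s + 1"
proof -
  have "\<not> depth \<nu> s + 2 \<le> depth \<nu> (s + 1)"
    using le_depth_iff[OF assms, of "depth \<nu> s + 2" "s + 1"] le_depth_iff[OF assms, of "depth \<nu> s + 1" s]
      row_end_strict_mono[OF assms, of "depth \<nu> s + 1" "depth \<nu> s + 2"] by auto
  then show ?thesis using depth_mono[OF assms, of s "s + 1"] by auto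
qed

lemma depth_ge: "is_partition \<nu> \<Longrightarrow> s \<le> int (depth \<nu> s)"
  using le_depth_iff[of \<nu> "nat s" s] row_end_le[of \<nu> "nat s"] by (cases "0 \<le> s") auto

lemma depth_gt: 
  assumes "is_partition \<nu>" "s < int (length \<nu>)"
  shows "s < int (depth \<nu> s)"
proof (cases "0 \<le> s")
  case True
  then have "nat s + 1 \<le> length \<nu>" using assms(2) by linarith
  then have "nat s + 1 \<le> depth \<nu> s"
    using True le_depth_iff[of \<nu> "nat s + 1" s] row_end_within[of \<nu> "nat s + 1"] assms by simp
  then show ?thesis by simp
qed simp

lemma depth_row_end: 
  assumes "is_partition \<nu>" "1 \<le> i"
  shows "depth \<nu> (row_end \<nu> i) = i" "depth \<nu> (row_end \<nu> i - 1) = i - 1"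
proof -
  have "i \<le> depth \<nu> (row_end \<nu> i)" "\<not> i + 1 \<le> depth \<nu> (row_end \<nu> i)"
    using assms row_end_strict_mono[of \<nu> i "i + 1"] by (auto simp: le_depth_iff)
  then show "depth \<nu> (row_end \<nu> i) = i" by simp
  have "\<not> i \<le> depth \<nu> (row_end \<nu> i - 1)" using assms by (auto simp: le_depth_iff)
  moreover have "i - 1 \<le> depth \<nu> (row_end \<nu> i - 1)"
    using assms row_end_strict_mono[of \<nu> "i - 1" i] by (force simp: le_depth_iff)
  ultimately show "depth \<nu> (row_end \<nu> i - 1) = i - 1" by simp
qed

lemma depth_eq_iff:
  assumes "is_partition \<nu>" "1 \<le> i"
  shows "depth \<nu> s = i \<longleftrightarrow> row_end \<nu> i \<le> s \<and> s < row_end \<nu> (i + 1)"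
  using le_depth_iff[OF assms(1), of i s] le_depth_iff[OF assms(1), of "i + 1" s] assms(2)
  by auto

lemma young_diagram_iff:
  assumes "is_partition \<nu>"
  shows "(i, j) \<in> young_diagram \<nu> \<longleftrightarrow> 1 \<le> i \<and> 1 \<le> j \<and> i \<le> depth \<nu> (int i - int j)"
  using le_depth_iff[OF assms, of i "int i - int j"] by (auto simp: young_diagram_def row_end_def)

text \<open>A full piece ends on diagonal \<open>row_end + b - 1\<close>, in the row given by
  \<open>depth\<close>, and the next piece starts one row lower. The recursion continues past the
  last row, as \<open>greedy_path\<close> requires.\<close>

primrec start_row :: "nat \<Rightarrow> nat list \<Rightarrow> nat \<Rightarrow> nat" where
  "start_row b \<nu> 0 = 1"
| "start_row b \<nu> (Suc p) = depth \<nu> (row_end \<nu> (start_row b \<nu> p) + int b - 1) + 1"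

text \<open>The south step along row \<open>i\<close> leads from diagonal
  \<open>row_end \<nu> i - 1\<close> to \<open>row_end \<nu> i\<close>. Hence the rim box on
  diagonal \<open>s\<close> belongs to the step at \<open>s - 1\<close>, a shift that recurs
  below.\<close>

definition piece_start :: "nat \<Rightarrow> nat list \<Rightarrow> nat \<Rightarrow> int" where
  "piece_start b \<nu> p = row_end \<nu> (start_row b \<nu> p) - 1"

lemma start_row_pos: "1 \<le> start_row b \<nu> p"
  by (cases p) auto

lemma greedy_path_partition:
  assumes "is_partition \<nu>" "0 < b"
  shows "greedy_path (\<lambda>s. int (depth \<nu> s)) (int b) (piece_start b \<nu>)"
proof
  fix p s
  let ?i = "start_row b \<nu> (Suc p)"
  show "int (depth \<nu> (s + 1)) = int (depth \<nu> s) \<or> int (depth \<nu> (s + 1)) = int (depth \<nu> s) + 1"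
    using depth_step[OF assms(1), of s] by auto
  show "int (depth \<nu> (piece_start b \<nu> 0)) = 0"
    using depth_row_end[OF assms(1), of 1] by (simp add: piece_start_def)
  show "int (depth \<nu> (piece_start b \<nu> p + 1)) = int (depth \<nu> (piece_start b \<nu> p)) + 1"
    using depth_row_end[OF assms(1) start_row_pos[of b \<nu> p]] start_row_pos[of b \<nu> p]
    by (simp add: piece_start_def)
  have "\<not> ?i \<le> depth \<nu> (row_end \<nu> (start_row b \<nu> p) + int b - 1)" by simp
  then show "piece_start b \<nu> p + int b \<le> piece_start b \<nu> (Suc p)"
    unfolding le_depth_iff[OF assms(1)] by (simp add: piece_start_def)
  assume s: "piece_start b \<nu> p + int b \<le> s" "s < piece_start b \<nu> (Suc p)"
  have "\<not> ?i \<le> depth \<nu> (s + 1)"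
    using s(2) start_row_pos[of b \<nu> "Suc p"] unfolding le_depth_iff[OF assms(1)] piece_start_def by simp
  moreover have "?i \<le> depth \<nu> s + 1"
    using depth_mono[OF assms(1) s(1)] by (simp add: piece_start_def algebra_simps)
  ultimately show "int (depth \<nu> (s + 1)) = int (depth \<nu> s)"
    using depth_mono[OF assms(1), of s "s + 1"] by simp
qed (use assms in auto)

declare start_row.simps(2) [simp del]

section \<open>The \<open>b\<close>-rim along the boundary path\<close>

lemma takeWhile_map_upt:
  assumes "n \<le> m" "\<And>t. t < n \<Longrightarrow> P (f t)" "n < m \<Longrightarrow> \<not> P (f n)"
  shows "takeWhile P (map f [0..<m]) = map f [0..<n]"
proof -
  have "[0..<m] = [0..<n] @ [n..<m]" using upt_add_eq_append[of 0 n "m - n"] assms(1) by simp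
  moreover have "takeWhile P (map f [n..<m]) = []"
    using assms(3) by (cases "n < m") (auto simp: upt_conv_Cons)
  moreover have "takeWhile P (map f [0..<n] @ ys) = map f [0..<n] @ takeWhile P ys" for ys
    using assms(2) by (intro takeWhile_append2) auto
  ultimately show ?thesis by simp
qed

lemma part_filter_pos:
  "sorted_wrt (\<ge>) xs \<Longrightarrow> part (filter (\<lambda>x. 0 < x) xs) i = part xs i"
proof (induction xs arbitrary: i)
  case (Cons x xs)
  show ?case
  proof (cases "x = 0")
    case True
    then have zero: "\<forall>y\<in>set (x # xs). y = 0" using Cons.prems by auto
    then have "filter (\<lambda>x. 0 < x) (x # xs) = []" by (simp add: filter_empty_conv)
    moreover have "part (x # xs) i = 0"
      unfolding part_def using zero nth_mem[of "i - 1" "x # xs"] by auto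
    ultimately show ?thesis by (simp add: part_def)
  next
    case False
    have "part (x # ys) i = (if i = 1 then x else part ys (i - 1))" for ys
      by (auto simp: part_def nth_Cons')
    then show ?thesis using Cons False by simp
  qed
qed (simp add: part_def)

lemma is_partition_filter_pos:
  "sorted_wrt (\<ge>) xs \<Longrightarrow> is_partition (filter (\<lambda>x. 0 < x) xs)"
  by (simp add: is_partition_def sorted_wrt_filter)

lemma finite_young_diagram: "finite (young_diagram \<nu>)"
proof -
  have "young_diagram \<nu> \<subseteq> (SIGMA i:{1..length \<nu>}. {1..part \<nu> i})"
    by (auto simp: young_diagram_def part_def split: if_splits)
  then show ?thesis by (rule finite_subset) simp
qed

lemma young_diagram_rows: "(i, j) \<in> young_diagram \<nu> \<Longrightarrow> 1 \<le> i \<and> i \<le> length \<nu>"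
  by (auto simp: young_diagram_def part_def split: if_splits)

lemma sum_row_lengths:
  assumes "finite A" "\<And>i j. (i, j) \<in> A \<Longrightarrow> 1 \<le> i \<and> i \<le> n"
  shows "sum_list (map (\<lambda>i. card {j. (i, j) \<in> A}) [1..<Suc n]) = card A"
proof -
  have A: "A = (SIGMA i:{1..<Suc n}. {j. (i, j) \<in> A})"
    using assms(2) by (auto simp: less_Suc_eq_le)
  have "finite {j. (i, j) \<in> A}" for i
    by (rule finite_subset[of _ "snd ` A"]) (use assms(1) in force)+
  then have "card A = (\<Sum>i\<in>{1..<Suc n}. card {j. (i, j) \<in> A})"
    by (subst A, subst card_SigmaI) auto
  then show ?thesis by (simp add: sum_list_distinct_conv_sum_set del: upt_Suc sum.op_ivl_Suc)
qed

lemma sum_list_eq_card: "sum_list \<nu> = card (young_diagram \<nu>)"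
proof -
  have "card {j. (i, j) \<in> young_diagram \<nu>} = part \<nu> i" if "1 \<le> i" for i
  proof -
    have "{j. (i, j) \<in> young_diagram \<nu>} = {1..part \<nu> i}" using that by (auto simp: young_diagram_def)
    then show ?thesis by simp
  qed
  then have rows: "map (\<lambda>i. card {j. (i, j) \<in> young_diagram \<nu>}) [1..<Suc (length \<nu>)] = \<nu>"
    by (intro nth_equalityI) (auto simp: part_def simp del: upt_Suc)
  have "sum_list (map (\<lambda>i. card {j. (i, j) \<in> young_diagram \<nu>}) [1..<Suc (length \<nu>)]) = card (young_diagram \<nu>)"
    by (intro sum_row_lengths finite_young_diagram young_diagram_rows)
  then show ?thesis unfolding rows .
qed

locale rim_removal =
  fixes b :: nat and \<nu> :: "nat list"
  assumes partition: "is_partition \<nu>" and b_gt_0: "0 < b" and nonempty: "\<nu> \<noteq> []"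
begin

sublocale greedy_path "\<lambda>s. int (depth \<nu> s)" "int b" "piece_start b \<nu>"
  by (rule greedy_path_partition[OF partition b_gt_0])

abbreviation k :: nat where "k \<equiv> length \<nu>"

abbreviation r :: "nat \<Rightarrow> nat" where "r \<equiv> start_row b \<nu>"

text \<open>The rim box on diagonal \<open>s\<close>, if that diagonal meets the diagram.\<close>

definition rim_box :: "int \<Rightarrow> nat \<times> nat" where
  "rim_box s = (depth \<nu> s, nat (int (depth \<nu> s) - s))"

lemma rim_box_inj: "inj rim_box"
proof (rule injI)
  fix s t
  assume "rim_box s = rim_box t"
  then show "s = t" using depth_ge[OF partition, of s] depth_ge[OF partition, of t]
    by (auto simp: rim_box_def)
qed

lemma rim_step_rim_box:
  assumes "s < int k" "1 \<le> depth \<nu> s"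
  shows "rim_step \<nu> (rim_box s) = rim_box (s + 1)"
proof -
  have gt: "s < int (depth \<nu> s)" using depth_gt[OF partition assms(1)] .
  then have "1 \<le> nat (int (depth \<nu> s) - s)" by linarith
  then have "(depth \<nu> s + 1, nat (int (depth \<nu> s) - s)) \<in> young_diagram \<nu> \<longleftrightarrow> depth \<nu> s + 1 \<le> depth \<nu> (s + 1)"
    using gt unfolding young_diagram_iff[OF partition] by (simp add: algebra_simps)
  then show ?thesis
    using depth_step[OF partition, of s] gt by (auto simp: rim_step_def rim_box_def)
qed

lemma rim_step_power:
  assumes "1 \<le> i" "row_end \<nu> i + int t \<le> int k"
  shows "(rim_step \<nu> ^^ t) (i, part \<nu> i) = rim_box (row_end \<nu> i + int t)"
  using assms(2)
proof (induction t)
  case 0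
  then show ?case using depth_row_end[OF partition assms(1)] by (simp add: rim_box_def row_end_def)
next
  case (Suc t)
  have "i \<le> depth \<nu> (row_end \<nu> i + int t)" using le_depth_iff[OF partition] by simp
  then show ?case
    using Suc assms(1) rim_step_rim_box[of "row_end \<nu> i + int t"] by (simp add: algebra_simps)
qed

lemma rim_box_in_rim_iff:
  assumes "1 \<le> depth \<nu> s" "s \<le> int k"
  shows "rim_box s \<in> rim \<nu> \<longleftrightarrow> s < int k"
proof (cases "s < int k")
  case True
  have gt: "s < int (depth \<nu> s)" using depth_gt[OF partition True] .
  then show ?thesis using True assms
    by (simp add: rim_def rim_box_def young_diagram_iff[OF partition])
next
  case False
  have "\<not> k + 1 \<le> depth \<nu> (int k)"
    unfolding le_depth_iff[OF partition] using row_end_beyond[of \<nu> "k + 1"] by simp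
  then show ?thesis using False assms by (simp add: rim_def rim_box_def young_diagram_iff[OF partition])
qed

definition piece_length :: "nat \<Rightarrow> nat" where
  "piece_length i = min b (nat (int k - row_end \<nu> i))"

lemma rim_piece_eq:
  assumes "1 \<le> i"
  shows "rim_piece b \<nu> i = map (\<lambda>t. rim_box (row_end \<nu> i + int t)) [0..<piece_length i]"
proof -
  have box: "(rim_step \<nu> ^^ t) (i, part \<nu> i) = rim_box (row_end \<nu> i + int t)"
    if "t \<le> piece_length i" "row_end \<nu> i \<le> int k" for t
    using that by (intro rim_step_power[OF assms]) (auto simp: piece_length_def)
  have pos: "1 \<le> depth \<nu> (row_end \<nu> i + int t)" for t
    using le_depth_iff[OF partition, of i "row_end \<nu> i + int t"] assms by simp
  show ?thesis
  proof (cases "row_end \<nu> i \<le> int k")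
    case True
    have "rim_piece b \<nu> i = map (\<lambda>t. (rim_step \<nu> ^^ t) (i, part \<nu> i)) [0..<piece_length i]"
      unfolding rim_piece_def
    proof (rule takeWhile_map_upt)
      show "piece_length i \<le> b" by (simp add: piece_length_def)
      show "(rim_step \<nu> ^^ t) (i, part \<nu> i) \<in> rim \<nu>" if "t < piece_length i" for t
      proof -
        have "row_end \<nu> i + int t < int k" using that unfolding piece_length_def by linarith
        then show ?thesis using box[of t] rim_box_in_rim_iff[OF pos, of t] that True by simp
      qed
      show "(rim_step \<nu> ^^ piece_length i) (i, part \<nu> i) \<notin> rim \<nu>" if "piece_length i < b"
      proof -
        have "row_end \<nu> i + int (piece_length i) = int k"
          using that True unfolding piece_length_def by linarith
        then show ?thesis
          using box[of "piece_length i"] rim_box_in_rim_iff[OF pos, of "piece_length i"] True by simp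
      qed
    qed
    then show ?thesis using box True by simp
  next
    case False
    then have "k < i" using row_end_le[of \<nu> i] by linarith
    then have "(i, part \<nu> i) \<notin> rim \<nu>" by (simp add: rim_def young_diagram_def part_eq_0)
    then have "rim_piece b \<nu> i = []"
      using takeWhile_map_upt[of 0 b "\<lambda>p. p \<in> rim \<nu>" "\<lambda>t. (rim_step \<nu> ^^ t) (i, part \<nu> i)"]
      by (simp add: rim_piece_def)
    then show ?thesis using False by (simp add: piece_length_def)
  qed
qed

text \<open>A full piece hands over to the row given by \<open>start_row\<close>. A truncated one
  ends in row \<open>k\<close>, while \<open>start_row\<close> goes on counting \<open>b\<close>
  diagonals; the two rows may then differ, but both lie below the diagram.\<close>

lemma next_piece_row:
  assumes "r p \<le> k"
  shows "fst (last (rim_piece b \<nu> (r p))) + 1 = r (Suc p) \<or>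
         \<not> fst (last (rim_piece b \<nu> (r p))) + 1 \<le> k \<and> \<not> r (Suc p) \<le> k"
proof -
  let ?e = "row_end \<nu> (r p)"
  have r1: "1 \<le> r p" by (rule start_row_pos)
  have "?e < int k" using row_end_within[OF partition r1 assms] assms by simp
  then have n: "0 < piece_length (r p)" using b_gt_0 by (simp add: piece_length_def)
  then have last: "fst (last (rim_piece b \<nu> (r p))) = depth \<nu> (?e + int (piece_length (r p)) - 1)"
    by (simp add: rim_piece_eq[OF r1] last_conv_nth rim_box_def of_nat_diff algebra_simps)
  show ?thesis
  proof (cases "?e + int b \<le> int k")
    case True
    then have "piece_length (r p) = b" by (simp add: piece_length_def)
    then show ?thesis using last by (simp add: start_row.simps)
  next
    case False
    then have "?e + int (piece_length (r p)) = int k" using \<open>?e < int k\<close> by (simp add: piece_length_def)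
    then have "k \<le> depth \<nu> (?e + int (piece_length (r p)) - 1)"
      using depth_gt[OF partition, of "int k - 1"] by simp
    moreover have "k \<le> depth \<nu> (?e + int b - 1)"
      using depth_gt[OF partition, of "int k - 1"] depth_mono[OF partition, of "int k - 1" "?e + int b - 1"] False
      by simp
    ultimately show ?thesis using last by (simp add: start_row.simps)
  qed
qed

lemma piece_start_mono: "p \<le> q \<Longrightarrow> piece_start b \<nu> p \<le> piece_start b \<nu> q"
proof (induction q rule: dec_induct)
  case (step q)
  then show ?case using spaced[of q] by linarith
qed simp

lemma start_row_mono: "p \<le> q \<Longrightarrow> r p \<le> r q"
  using piece_start_mono[of p q] row_end_less_iff[OF partition start_row_pos start_row_pos, of b \<nu> q b \<nu> p]
  by (auto simp: piece_start_def not_less[symmetric])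

lemma piece_rows_eq: "piece_rows b \<nu> = {r p |p. r p \<le> k}"
proof (intro subset_antisym subsetI)
  fix i
  assume "i \<in> piece_rows b \<nu>"
  then show "i \<in> {r p |p. r p \<le> k}"
  proof induction
    case first
    then show ?case by (auto intro!: exI[of _ 0] simp: Suc_le_eq)
  next
    case (step i)
    then obtain p where "i = r p" "r p \<le> k" by blast
    moreover have "fst (last (rim_piece b \<nu> i)) + 1 = r (Suc p)"
      using next_piece_row[of p] step.hyps(2) calculation by simp
    ultimately show ?case using step by auto
  qed
next
  fix i
  assume "i \<in> {r p |p. r p \<le> k}"
  then obtain p where "i = r p" "r p \<le> k" by blast
  moreover have "r p \<le> k \<Longrightarrow> r p \<in> piece_rows b \<nu>" for p
  proof (induction p)
    case 0
    then show ?case using piece_rows.first[OF nonempty] by simp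
  next
    case (Suc p)
    then have "r p \<le> k" using start_row_mono[of p "Suc p"] by simp
    then show ?case
      using Suc piece_rows.step[of "r p" b \<nu>] next_piece_row[of p] by auto
  qed
  ultimately show "i \<in> piece_rows b \<nu>" by simp
qed

lemma pred_covered_iff: "s - 1 \<in> covered \<longleftrightarrow> (\<exists>p. row_end \<nu> (r p) \<le> s \<and> s < row_end \<nu> (r p) + int b)"
  unfolding covered_def piece_start_def mem_Collect_eq by (intro ex_cong1) auto

lemma b_rim_eq: "b_rim b \<nu> = rim_box ` {s. s < int k \<and> s - 1 \<in> covered}"
proof -
  have "b_rim b \<nu> = (\<Union>p\<in>{p. r p \<le> k}. rim_box ` {s. row_end \<nu> (r p) \<le> s \<and> s < row_end \<nu> (r p) + int b \<and> s < int k})"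
  proof -
    have "set (rim_piece b \<nu> (r p)) =
        rim_box ` {s. row_end \<nu> (r p) \<le> s \<and> s < row_end \<nu> (r p) + int b \<and> s < int k}" for p
    proof -
      let ?e = "row_end \<nu> (r p)"
      have "{s. ?e \<le> s \<and> s < ?e + int b \<and> s < int k} = (\<lambda>t. ?e + int t) ` {0..<piece_length (r p)}"
      proof (intro subset_antisym subsetI)
        fix s
        assume "s \<in> {s. ?e \<le> s \<and> s < ?e + int b \<and> s < int k}"
        then show "s \<in> (\<lambda>t. ?e + int t) ` {0..<piece_length (r p)}"
          by (intro image_eqI[of _ _ "nat (s - ?e)"]) (auto simp: piece_length_def)
      qed (auto simp: piece_length_def)
      then show ?thesis by (simp add: rim_piece_eq[OF start_row_pos] image_image)
    qed
    then show ?thesis by (auto simp: b_rim_def piece_rows_eq)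
  qed
  also have "\<dots> = rim_box ` {s. s < int k \<and> s - 1 \<in> covered}"
  proof -
    have "r p \<le> k" if "row_end \<nu> (r p) \<le> s" "s < int k" for p s
      using that row_end_beyond[of \<nu> "r p"] by (cases "r p \<le> k") auto
    then show ?thesis unfolding pred_covered_iff by blast
  qed
  finally show ?thesis .
qed

text \<open>Let \<open>p\<close> be the last piece that starts in row \<open>i\<close> or above. The
  next piece starts below row \<open>i\<close>, so piece \<open>p\<close> reaches the end of the row
  and covers the row up to its own last diagonal. Boxes of the row on diagonals from
  \<open>e\<close> on survive.\<close>

lemma row_uncovered_from:
  assumes "1 \<le> i"
  shows "\<exists>e. row_end \<nu> i < e \<and> e \<le> row_end \<nu> (i + 1) \<and>
    (\<forall>s. row_end \<nu> i \<le> s \<and> s < row_end \<nu> (i + 1) \<longrightarrow> (s - 1 \<in> covered \<longleftrightarrow> s < e))"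
proof -
  have "strict_mono r"
    unfolding strict_mono_Suc_iff
  proof
    fix p
    have "piece_start b \<nu> p < piece_start b \<nu> (Suc p)" using spaced[of p] b_gt_0 by linarith
    then show "r p < r (Suc p)"
      using row_end_less_iff[OF partition start_row_pos start_row_pos, of b \<nu> p b \<nu> "Suc p"]
      unfolding piece_start_def by linarith
  qed
  then have "p \<le> r p" for p by (rule strict_mono_imp_increasing)
  then have bounded: "\<And>p. r p \<le> i \<Longrightarrow> p \<le> i" using le_trans by blast
  define p where "p = (GREATEST p. r p \<le> i)"
  have p: "r p \<le> i" unfolding p_def
    by (rule GreatestI_nat[of "\<lambda>p. r p \<le> i" 0 i]) (use assms bounded in auto)
  have p_max: "q \<le> p" if "r q \<le> i" for q
    unfolding p_def by (rule Greatest_le_nat[of "\<lambda>p. r p \<le> i" q i]) (use that bounded in auto)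
  have "\<not> r (Suc p) \<le> i" using p_max[of "Suc p"] by auto
  then have lt: "row_end \<nu> i < row_end \<nu> (r p) + int b"
    using le_depth_iff[OF partition, of i "row_end \<nu> (r p) + int b - 1"] assms by (auto simp: start_row.simps)
  let ?e = "min (row_end \<nu> (i + 1)) (row_end \<nu> (r p) + int b)"
  have "s - 1 \<in> covered \<longleftrightarrow> s < ?e" if s: "row_end \<nu> i \<le> s" "s < row_end \<nu> (i + 1)" for s
  proof
    assume "s - 1 \<in> covered"
    then obtain q where q: "row_end \<nu> (r q) \<le> s" "s < row_end \<nu> (r q) + int b"
      unfolding pred_covered_iff by blast
    then have "r q < i + 1"
      using row_end_less_iff[OF partition start_row_pos, of "i + 1" b \<nu> q] s by auto
    then have "r q \<le> r p" using p_max[of q] start_row_mono by simp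
    then show "s < ?e" using q s row_end_mono[OF partition start_row_pos, of b \<nu> q "r p"] by simp
  next
    assume "s < ?e"
    then show "s - 1 \<in> covered"
      using row_end_mono[OF partition start_row_pos p] s unfolding pred_covered_iff by (intro exI[of _ p]) auto
  qed
  then show ?thesis
    using lt row_end_strict_mono[OF partition assms, of "i + 1"] by (intro exI[of _ ?e]) auto
qed

end

section \<open>The map J as a transformation of depth functions\<close>

context rim_removal
begin

text \<open>All pieces before the last have \<open>b\<close> boxes, so divisibility means that the
  last piece is full as well. This holds iff it stops before diagonal \<open>k\<close>, which
  belongs to the step at \<open>k - 1\<close>.\<close>

lemma rim_length_dvd_iff:
  "b dvd sum_list \<nu> - sum_list (remove_b_rim b \<nu>) \<longleftrightarrow> int k - 1 \<notin> covered"
proof -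
  let ?e = "\<lambda>p. row_end \<nu> (r p)"
  let ?S = "{s. s < int k \<and> s - 1 \<in> covered}"
  have sub: "b_rim b \<nu> \<subseteq> young_diagram \<nu>"
    unfolding b_rim_def rim_piece_def rim_def by (auto dest!: set_takeWhileD)
  have "sum_list (remove_b_rim b \<nu>) = card (young_diagram \<nu> - b_rim b \<nu>)"
    unfolding remove_b_rim_def
    by (rule sum_row_lengths) (use finite_young_diagram young_diagram_rows in auto)
  then have "sum_list \<nu> - sum_list (remove_b_rim b \<nu>) = card (b_rim b \<nu>)"
    using card_Diff_subset[OF finite_subset[OF sub finite_young_diagram] sub]
      card_mono[OF finite_young_diagram sub] by (simp add: sum_list_eq_card)
  also have "\<dots> = card ?S"
    unfolding b_rim_eq by (intro card_image inj_on_subset[OF rim_box_inj]) simp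
  finally have \<phi>: "sum_list \<nu> - sum_list (remove_b_rim b \<nu>) = card ?S" .

  have spaced': "?e p + int b \<le> ?e q" if "p < q" for p q
  proof -
    have "?e p + int b \<le> ?e (Suc p)" using spaced[of p] by (simp add: piece_start_def)
    also have "\<dots> \<le> ?e q" using piece_start_mono[of "Suc p" q] that by (simp add: piece_start_def)
    finally show ?thesis .
  qed
  \<comment> \<open>Row ends inside the diagram lie before diagonal \<open>k\<close> and those below
    it lie beyond. So no piece starts on diagonal \<open>k\<close>, and only the last piece can
    cover it.\<close>
  have e_ne: "?e p \<noteq> int k" for p
    using row_end_within[OF partition start_row_pos, of b \<nu> p] row_end_beyond[of \<nu> "r p"]
    by (cases "r p \<le> k") auto
  have "1 \<le> k" using nonempty by (simp add: Suc_le_eq)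
  then have "?e 0 < int k" using row_end_within[OF partition, of 1] by simp
  have grow: "?e 0 + int p \<le> ?e p" for p
  proof (induction p)
    case (Suc p)
    then show ?case using spaced'[of p "Suc p"] b_gt_0 by simp
  qed simp
  define P where "P = (GREATEST p. ?e p < int k)"
  have bounded: "p \<le> nat (int k - ?e 0)" if "?e p < int k" for p using grow[of p] that by simp
  have P: "?e P < int k" unfolding P_def
    by (rule GreatestI_nat[of "\<lambda>p. ?e p < int k" 0 "nat (int k - ?e 0)"]) (use \<open>?e 0 < int k\<close> bounded in auto)
  have P_max: "p \<le> P" if "?e p < int k" for p
    unfolding P_def
    by (rule Greatest_le_nat[of "\<lambda>p. ?e p < int k" p "nat (int k - ?e 0)"]) (use that bounded in auto)

  let ?U = "\<Union>p<P. {?e p..<?e p + int b}" and ?V = "{?e P..<min (?e P + int b) (int k)}"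
  have "?S = ?U \<union> ?V"
  proof (intro subset_antisym subsetI)
    fix s
    assume "s \<in> ?S"
    then obtain p where p: "?e p \<le> s" "s < ?e p + int b" "s < int k"
      unfolding mem_Collect_eq pred_covered_iff by blast
    then have "p \<le> P" using P_max[of p] by simp
    then show "s \<in> ?U \<union> ?V" using p by (cases "p = P") auto
  next
    fix s
    assume "s \<in> ?U \<union> ?V"
    then show "s \<in> ?S"
    proof
      assume "s \<in> ?U"
      then obtain p where p: "p < P" "?e p \<le> s" "s < ?e p + int b" by auto
      moreover have "s < int k" using p spaced'[of p P] P by linarith
      ultimately show ?thesis unfolding mem_Collect_eq pred_covered_iff by blast
    next
      assume "s \<in> ?V"
      then have "?e P \<le> s" "s < ?e P + int b" "s < int k" by auto
      then show ?thesis unfolding mem_Collect_eq pred_covered_iff by blast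
    qed
  qed
  moreover have "?U \<inter> ?V = {}"
  proof (intro equals0I)
    fix s
    assume "s \<in> ?U \<inter> ?V"
    then obtain p where "p < P" "s < ?e p + int b" "?e P \<le> s" by auto
    then show False using spaced'[of p P] by linarith
  qed
  moreover have "card ?U = P * b"
  proof -
    have "card ?U = (\<Sum>p<P. card {?e p..<?e p + int b})"
    proof (rule card_UN_disjoint)
      show "\<forall>p\<in>{..<P}. \<forall>q\<in>{..<P}. p \<noteq> q \<longrightarrow> {?e p..<?e p + int b} \<inter> {?e q..<?e q + int b} = {}"
      proof (intro ballI impI)
        fix p q :: nat
        assume "p \<noteq> q"
        then show "{?e p..<?e p + int b} \<inter> {?e q..<?e q + int b} = {}"
          using spaced'[of p q] spaced'[of q p] by (cases "p < q") auto
      qed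
    qed auto
    then show ?thesis by simp
  qed
  moreover have "card ?V = min b (nat (int k - ?e P))"
    using P unfolding card_atLeastLessThan_int by linarith
  ultimately have "card ?S = P * b + min b (nat (int k - ?e P))"
    using card_Un_disjoint[of ?U ?V] by simp
  then have "b dvd card ?S \<longleftrightarrow> b dvd min b (nat (int k - ?e P))"
    by (simp add: dvd_add_right_iff)
  also have "\<dots> \<longleftrightarrow> ?e P + int b \<le> int k"
  proof
    assume "b dvd min b (nat (int k - ?e P))"
    then have "b \<le> min b (nat (int k - ?e P))" using P b_gt_0 by (intro dvd_imp_le) auto
    then show "?e P + int b \<le> int k" using P by linarith
  next
    assume "?e P + int b \<le> int k"
    then have "min b (nat (int k - ?e P)) = b" by linarith
    then show "b dvd min b (nat (int k - ?e P))" by simp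
  qed
  also have "\<dots> \<longleftrightarrow> int k - 1 \<notin> covered"
  proof
    assume le: "?e P + int b \<le> int k"
    show "int k - 1 \<notin> covered"
    proof
      assume "int k - 1 \<in> covered"
      then obtain p where p: "?e p \<le> int k" "int k < ?e p + int b" unfolding pred_covered_iff by blast
      then have "p \<le> P" using P_max[of p] e_ne[of p] by simp
      then show False using spaced'[of p P] p le P by (cases "p = P") auto
    qed
  next
    assume "int k - 1 \<notin> covered"
    then have "\<not> (?e P \<le> int k \<and> int k < ?e P + int b)" unfolding pred_covered_iff by blast
    then show "?e P + int b \<le> int k" using P by linarith
  qed
  finally show ?thesis using \<phi> by simp
qed

text \<open>With \<open>e i\<close> from \<open>row_uncovered_from\<close>, row \<open>i\<close>
  keeps \<open>i - e i\<close> boxes and gains one, so it ends on diagonal \<open>e i - 1\<close>.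
  Translated back to depths, this is \<open>E\<close>.\<close>

lemma J_map_boundary: "is_partition (J_map b \<nu>) \<and> (\<forall>s. int (depth (J_map b \<nu>) s) = E s)"
proof -
  have "\<forall>i. \<exists>e. 1 \<le> i \<longrightarrow> row_end \<nu> i < e \<and> e \<le> row_end \<nu> (i + 1) \<and>
      (\<forall>s. row_end \<nu> i \<le> s \<and> s < row_end \<nu> (i + 1) \<longrightarrow> (s - 1 \<in> covered \<longleftrightarrow> s < e))"
    using row_uncovered_from by blast
  from choice[OF this] obtain e where
      "\<forall>i. 1 \<le> i \<longrightarrow> row_end \<nu> i < e i \<and> e i \<le> row_end \<nu> (i + 1) \<and>
      (\<forall>s. row_end \<nu> i \<le> s \<and> s < row_end \<nu> (i + 1) \<longrightarrow> (s - 1 \<in> covered \<longleftrightarrow> s < e i))" ..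
  then have e: "row_end \<nu> i < e i" "e i \<le> row_end \<nu> (i + 1)"
      "\<And>s. row_end \<nu> i \<le> s \<Longrightarrow> s < row_end \<nu> (i + 1) \<Longrightarrow> s - 1 \<in> covered \<longleftrightarrow> s < e i"
    if "1 \<le> i" for i
    using that by blast+
  have e_le: "e i \<le> int i + 1" if "1 \<le> i" for i
    using e(2)[OF that] row_end_le[of \<nu> "i + 1"] by simp
  have e_le': "e i \<le> int i" if "1 \<le> i" "i < k" for i
    using e(2)[OF that(1)] row_end_within[OF partition, of "i + 1"] that by simp
  have k1: "1 \<le> k" using nonempty by (simp add: Suc_le_eq)
  have \<mu>: "remove_b_rim b \<nu> = map (\<lambda>i. nat (int i - e i)) [1..<Suc k]"
    unfolding remove_b_rim_def
  proof (rule map_cong[OF refl])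
    fix i
    assume "i \<in> set [1..<Suc k]"
    then have i: "1 \<le> i" "i \<le> k" by auto
    have "(i, j) \<in> young_diagram \<nu> - b_rim b \<nu> \<longleftrightarrow> j \<in> {1..nat (int i - e i)}" for j
    proof (cases "(i, j) \<in> young_diagram \<nu>")
      case True
      then have j: "1 \<le> j" "row_end \<nu> i \<le> int i - int j" by (auto simp: young_diagram_def row_end_def)
      have "(i, j) \<in> b_rim b \<nu> \<longleftrightarrow> depth \<nu> (int i - int j) = i \<and> int i - int j - 1 \<in> covered"
      proof
        assume "(i, j) \<in> b_rim b \<nu>"
        then obtain s where s: "(i, j) = rim_box s" "s - 1 \<in> covered" unfolding b_rim_eq by blast
        then have "s = int i - int j" using depth_ge[OF partition, of s] by (simp add: rim_box_def)
        then show "depth \<nu> (int i - int j) = i \<and> int i - int j - 1 \<in> covered"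
          using s by (simp add: rim_box_def)
      next
        assume "depth \<nu> (int i - int j) = i \<and> int i - int j - 1 \<in> covered"
        moreover have "int i - int j < int k" using i j by simp
        ultimately show "(i, j) \<in> b_rim b \<nu>"
          unfolding b_rim_eq by (intro image_eqI[of _ _ "int i - int j"]) (auto simp: rim_box_def)
      qed
      also have "\<dots> \<longleftrightarrow> int i - int j < e i"
        using e(2)[OF i(1)] e(3)[OF i(1) j(2)] j(2) unfolding depth_eq_iff[OF partition i(1)] by auto
      finally show ?thesis using True j(1) by auto
    next
      case False
      then show ?thesis using e(1)[OF i(1)] i by (auto simp: young_diagram_def row_end_def)
    qed
    then have "{j. (i, j) \<in> young_diagram \<nu> - b_rim b \<nu>} = {1..nat (int i - e i)}" by blast
    then show "card {j. (i, j) \<in> young_diagram \<nu> - b_rim b \<nu>} = nat (int i - e i)" by simp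
  qed
  define f where "f i = nat (int i + 1 - e i)" for i
  have "J_map b \<nu> = filter (\<lambda>x. 0 < x) (map f [1..<Suc k])"
  proof -
    let ?\<delta> = "if b dvd sum_list \<nu> - sum_list (remove_b_rim b \<nu>) then 1 else 0 :: nat"
    have "Suc (nat (int i - e i)) = f i" if "1 \<le> i" "i < k" for i
      unfolding f_def using e_le'[OF that] by linarith
    then have "map (\<lambda>x. x + 1) (butlast (remove_b_rim b \<nu>)) = map f [1..<k]"
      using k1 by (auto simp: \<mu>)
    \<comment> \<open>If \<open>e k = k + 1\<close>, the truncated \<open>nat (int k - e k)\<close>
      and \<open>\<delta>\<close> are both 0, in agreement with \<open>f k = 0\<close>; otherwise
      \<open>\<delta> = 1\<close> is the usual gain.\<close>
    moreover have "last (remove_b_rim b \<nu>) + ?\<delta> = f k"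
    proof -
      have "row_end \<nu> k \<le> int k" "int k < row_end \<nu> (k + 1)"
        using row_end_le[of \<nu> k] row_end_beyond[of \<nu> "k + 1"] by auto
      then have "int k - 1 \<in> covered \<longleftrightarrow> int k < e k" using e(3)[OF k1] by blast
      then show ?thesis
        unfolding rim_length_dvd_iff using e_le[OF k1] k1 by (auto simp: \<mu> f_def)
    qed
    moreover have "map f [1..<Suc k] = map f [1..<k] @ [f k]" using k1 by simp
    ultimately show ?thesis using nonempty by (simp only: J_map_def Let_def if_False)
  qed
  moreover have sorted: "sorted_wrt (\<ge>) (map f [1..<Suc k])"
  proof -
    have "f j \<le> f i" if "1 \<le> i" "i < j" for i j
    proof -
      have "int j - int i \<le> row_end \<nu> j - row_end \<nu> i"
        using part_antimono[OF partition, of i j] that by (simp add: row_end_def)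
      moreover have "int j - int (i + 1) \<le> row_end \<nu> j - row_end \<nu> (i + 1)"
        using part_antimono[OF partition, of "i + 1" j] that by (simp add: row_end_def)
      ultimately show ?thesis using e(1)[of j] e(2)[of i] that by (simp add: f_def)
    qed
    then show ?thesis
      by (auto simp: sorted_wrt_map intro!: sorted_wrt_mono_rel[OF _ sorted_wrt_upt] simp del: upt_Suc)
  qed
  ultimately have part: "is_partition (J_map b \<nu>)" and J: "part (J_map b \<nu>) i = part (map f [1..<Suc k]) i" for i
    using is_partition_filter_pos part_filter_pos by auto
  have J_end: "row_end (J_map b \<nu>) i = e i - 1" if "1 \<le> i" for i
  proof (cases "i \<le> k")
    case True
    then have "part (J_map b \<nu>) i = f i" using that unfolding J by (simp add: part_def del: upt_Suc)
    then show ?thesis using e_le[OF that] by (simp add: row_end_def f_def)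
  next
    case False
    then have "part (J_map b \<nu>) i = 0" unfolding J by (simp add: part_def del: upt_Suc)
    then show ?thesis
      using e(1,2)[OF that] False row_end_beyond[of \<nu> i] row_end_beyond[of \<nu> "i + 1"]
      by (simp add: row_end_def)
  qed
  have "int (depth (J_map b \<nu>) s) = E s" for s
  proof -
    \<comment> \<open>Only row \<open>d\<close> is in doubt: rows above it satisfy
      \<open>e i \<le> s + 1\<close>, rows below it do not, and row \<open>d\<close> fails to iff
      \<open>s\<close> is covered.\<close>
    define d where "d = depth \<nu> (s + 1)"
    define d' where "d' = (if s \<in> covered then d - 1 else d)"
    have d_gt: "s + 1 < row_end \<nu> (d + 1)" using le_depth_iff[OF partition, of "d + 1" "s + 1"] by (simp add: d_def)
    have d_le: "row_end \<nu> d \<le> s + 1" if "1 \<le> d" using le_depth_iff[OF partition, of d "s + 1"] that by (simp add: d_def)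
    have cov_pos: "1 \<le> d" if cov: "s \<in> covered"
    proof -
      obtain p where "row_end \<nu> (r p) \<le> s + 1" using cov pred_covered_iff[of "s + 1"] by auto
      then show ?thesis
        using le_depth_iff[OF partition, of "r p" "s + 1"] start_row_pos[of b \<nu> p] by (simp add: d_def)
    qed
    have "i \<le> depth (J_map b \<nu>) s \<longleftrightarrow> i \<le> d'" for i
    proof (cases "i = 0")
      case False
      then have i: "1 \<le> i" by simp
      have "i \<le> depth (J_map b \<nu>) s \<longleftrightarrow> e i \<le> s + 1"
        using le_depth_iff[OF part, of i s] J_end[OF i] i by auto
      moreover consider "i < d" | "i = d" | "d < i" by linarith
      then have "e i \<le> s + 1 \<longleftrightarrow> i \<le> d'"
      proof cases
        case 1
        have "row_end \<nu> (i + 1) \<le> row_end \<nu> d" using 1 by (intro row_end_mono[OF partition]) auto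
        then show ?thesis using e(2)[OF i] d_le 1 i by (auto simp: d'_def)
      next
        case 2
        have "s \<in> covered \<longleftrightarrow> s + 1 < e d" using e(3)[of d "s + 1"] d_le d_gt i 2 by simp
        then show ?thesis using 2 i by (auto simp: d'_def)
      next
        case 3
        have "row_end \<nu> (d + 1) \<le> row_end \<nu> i" using 3 by (intro row_end_mono[OF partition]) auto
        then show ?thesis using e(1)[OF i] d_gt 3 by (auto simp: d'_def)
      qed
      ultimately show ?thesis by simp
    qed simp
    then have "depth (J_map b \<nu>) s = d'" by (meson order_antisym order_refl)
    then show ?thesis using cov_pos by (simp add: E_def d'_def d_def of_nat_diff)
  qed
  then show ?thesis using part by blast
qed

end

section \<open>Column regularization along the boundary path\<close>

text \<open>Indices of the boxes of the ladder through \<open>(i, j)\<close> outside the partition with depth function \<open>D\<close>.\<close>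

definition missing :: "(int \<Rightarrow> int) \<Rightarrow> nat \<Rightarrow> nat \<Rightarrow> int \<Rightarrow> int \<Rightarrow> int set" where
  "missing D a b i j = {t. 1 \<le> i + t * int a \<and> 1 \<le> j - t * (int b - int a) \<and>
     D (i - j + t * int b) < i + t * int a}"

lemma int_le_div_iff:
  fixes k x d :: int
  assumes "0 < d"
  shows "k \<le> x div d \<longleftrightarrow> k * d \<le> x"
proof
  assume "k \<le> x div d"
  then have "k * d \<le> x div d * d" using assms by (intro mult_right_mono) auto
  also have "\<dots> \<le> x" using assms div_mult_mod_eq[of x d] pos_mod_sign[of d x] by linarith
  finally show "k * d \<le> x" .
next
  assume "k * d \<le> x"
  then have "k * d div d \<le> x div d" using assms by (rule zdiv_mono1)
  then show "k \<le> x div d" using assms by simp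
qed

lemma finite_ladder_index:
  assumes "0 < a" "a < b"
  shows "finite {t::int. c \<le> i + t * int a \<and> d \<le> j - t * (int b - int a)}"
proof (rule finite_subset)
  have "t \<le> max 0 (j - d)" if "d \<le> j - t * (int b - int a)" for t
  proof (cases "0 \<le> t")
    case True
    have "t * 1 \<le> t * (int b - int a)" using True assms by (intro mult_left_mono) auto
    then show ?thesis using that by simp
  qed simp
  moreover have "min 0 (c - i) \<le> t" if "c \<le> i + t * int a" for t
  proof (cases "t \<le> 0")
    case True
    have "t * int a \<le> t * 1" using True assms by (intro mult_left_mono_neg) auto
    then show ?thesis using that by simp
  qed simp
  ultimately show "{t. c \<le> i + t * int a \<and> d \<le> j - t * (int b - int a)} \<subseteq> {min 0 (c - i)..max 0 (j - d)}"
    by (simp add: subset_iff)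
qed simp

lemma finite_missing: "0 < a \<Longrightarrow> a < b \<Longrightarrow> finite (missing D a b i j)"
  by (rule finite_subset[OF _ finite_ladder_index[of a b 1 i 1 j]]) (auto simp: missing_def)

lemma ladder_eq:
  assumes "(i, j) \<in> ladder a b x y"
  shows "ladder a b x y = ladder a b (int i) (int j)"
proof -
  obtain u where u: "int i = x - u * int a" "int j = y + u * (int b - int a)"
    using assms by (auto simp: ladder_def)
  have "(\<exists>t. int i' = x - t * int a \<and> int j' = y + t * (int b - int a)) \<longleftrightarrow>
        (\<exists>t. int i' = int i - t * int a \<and> int j' = int j + t * (int b - int a))" for i' j'
  proof
    assume "\<exists>t. int i' = x - t * int a \<and> int j' = y + t * (int b - int a)"
    then obtain t where "int i' = x - t * int a" "int j' = y + t * (int b - int a)" by blast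
    then show "\<exists>t. int i' = int i - t * int a \<and> int j' = int j + t * (int b - int a)"
      by (intro exI[of _ "t - u"]) (simp add: u algebra_simps)
  next
    assume "\<exists>t. int i' = int i - t * int a \<and> int j' = int j + t * (int b - int a)"
    then obtain t where "int i' = int i - t * int a" "int j' = int j + t * (int b - int a)" by blast
    then show "\<exists>t. int i' = x - t * int a \<and> int j' = y + t * (int b - int a)"
      by (intro exI[of _ "t + u"]) (simp add: u algebra_simps)
  qed
  then show ?thesis unfolding ladder_def by simp
qed

lemma self_in_ladder: "0 < i \<Longrightarrow> 0 < j \<Longrightarrow> (i, j) \<in> ladder a b (int i) (int j)"
  by (auto simp: ladder_def intro!: exI[of _ 0])

lemma column_regularization_iff_lowest:
  "(i, j) \<in> column_regularization a b \<nu> \<longleftrightarrow> 0 < i \<and> 0 < j \<and>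
     (i, j) \<in> lowest (card (young_diagram \<nu> \<inter> ladder a b (int i) (int j))) (ladder a b (int i) (int j))"
proof
  assume "(i, j) \<in> column_regularization a b \<nu>"
  then obtain x y where xy: "(i, j) \<in> lowest (card (young_diagram \<nu> \<inter> ladder a b x y)) (ladder a b x y)"
    by (auto simp: column_regularization_def)
  then have mem: "(i, j) \<in> ladder a b x y" by (simp add: lowest_def)
  then have "0 < i \<and> 0 < j" by (simp add: ladder_def)
  then show "0 < i \<and> 0 < j \<and>
     (i, j) \<in> lowest (card (young_diagram \<nu> \<inter> ladder a b (int i) (int j))) (ladder a b (int i) (int j))"
    using xy unfolding ladder_eq[OF mem] by simp
qed (auto simp: column_regularization_def)

lemma ladder_image:
  "ladder a b (int i) (int j) = (\<lambda>t. (nat (int i + t * int a), nat (int j - t * (int b - int a)))) `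
     {t. 1 \<le> int i + t * int a \<and> 1 \<le> int j - t * (int b - int a)}"
proof (intro subset_antisym subsetI)
  fix p
  assume "p \<in> ladder a b (int i) (int j)"
  then obtain i' j' t where "p = (i', j')" "0 < i'" "0 < j'"
      "int i' = int i - t * int a" "int j' = int j + t * (int b - int a)" by (auto simp: ladder_def)
  then show "p \<in> (\<lambda>t. (nat (int i + t * int a), nat (int j - t * (int b - int a)))) `
     {t. 1 \<le> int i + t * int a \<and> 1 \<le> int j - t * (int b - int a)}"
    by (intro image_eqI[of _ _ "- t"]) auto
next
  fix p
  assume "p \<in> (\<lambda>t. (nat (int i + t * int a), nat (int j - t * (int b - int a)))) `
     {t. 1 \<le> int i + t * int a \<and> 1 \<le> int j - t * (int b - int a)}"
  then obtain t where "p = (nat (int i + t * int a), nat (int j - t * (int b - int a)))"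
     "1 \<le> int i + t * int a" "1 \<le> int j - t * (int b - int a)" by blast
  then show "p \<in> ladder a b (int i) (int j)" by (auto simp: ladder_def intro!: exI[of _ "- t"])
qed

text \<open>A point is selected iff fewer points of its ladder lie below it than the ladder has
  boxes in \<open>\<nu>\<close>. By complements, the missing points must be no more than the points
  above it, which number \<open>(i - 1) div a\<close>.\<close>

lemma column_regularization_iff:
  assumes "0 < a" "a < b" "is_partition \<nu>"
  shows "(i, j) \<in> column_regularization a b \<nu> \<longleftrightarrow> 1 \<le> i \<and> 1 \<le> j \<and>
    int (card (missing (\<lambda>s. int (depth \<nu> s)) a b (int i) (int j))) \<le> (int i - 1) div int a"
proof (cases "1 \<le> i \<and> 1 \<le> j")
  case True
  let ?T = "{t. 1 \<le> int i + t * int a \<and> 1 \<le> int j - t * (int b - int a)}"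
  let ?M = "missing (\<lambda>s. int (depth \<nu> s)) a b (int i) (int j)"
  let ?L = "ladder a b (int i) (int j)"
  let ?f = "\<lambda>t. (nat (int i + t * int a), nat (int j - t * (int b - int a)))"
  have fin: "finite ?T" by (rule finite_ladder_index[OF assms(1,2)])
  have inj: "inj_on ?f ?T"
  proof (rule inj_onI)
    fix t u
    assume "t \<in> ?T" "u \<in> ?T" "?f t = ?f u"
    then have "t * int a = u * int a" by (auto simp: eq_nat_nat_iff)
    then show "t = u" using assms(1) by simp
  qed
  have card_f: "card (?f ` A) = card A" if "A \<subseteq> ?T" for A
    by (rule card_image[OF inj_on_subset[OF inj that]])
  have below: "card {q \<in> ?L. i < fst q} = card {t \<in> ?T. 0 < t}"
  proof -
    have "{q \<in> ?L. i < fst q} = ?f ` {t \<in> ?T. 0 < t}"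
    proof -
      have "i < nat (int i + t * int a) \<longleftrightarrow> 0 < t" for t
        using assms(1) by (simp add: zless_nat_eq_int_zless zero_less_mult_iff)
      moreover have "{q \<in> ?L. i < fst q} = ?f ` {t \<in> ?T. i < fst (?f t)}"
        unfolding ladder_image by blast
      ultimately show ?thesis by (simp only: fst_conv)
    qed
    moreover have "{t \<in> ?T. 0 < t} \<subseteq> ?T" by blast
    ultimately show ?thesis using card_f by presburger
  qed
  have within: "card (young_diagram \<nu> \<inter> ?L) = card (?T - ?M)"
  proof -
    have "young_diagram \<nu> \<inter> ?L = ?f ` (?T - ?M)"
    proof -
      have "?f t \<in> young_diagram \<nu> \<longleftrightarrow> t \<notin> ?M" if "t \<in> ?T" for t
      proof -
        have eq: "int (nat (int i + t * int a)) - int (nat (int j - t * (int b - int a))) = int i - int j + t * int b"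
          using that by (simp add: algebra_simps)
        show ?thesis using that
          unfolding young_diagram_iff[OF assms(3)] eq missing_def by (auto simp: nat_le_iff)
      qed
      then show ?thesis unfolding ladder_image by blast
    qed
    moreover have "?T - ?M \<subseteq> ?T" by blast
    ultimately show ?thesis using card_f by presburger
  qed
  \<comment> \<open>Upwards along the ladder the columns grow, so only the row bound limits
    \<open>t\<close>.\<close>
  have above: "int (card {t \<in> ?T. t < 0}) = (int i - 1) div int a"
  proof -
    have "1 \<le> int j - t * (int b - int a)" if "t < 0" for t
    proof -
      have "t * (int b - int a) \<le> 0" using that assms by (intro mult_nonpos_nonneg) auto
      then show ?thesis using True by linarith
    qed
    moreover have "1 \<le> int i + t * int a \<longleftrightarrow> - ((int i - 1) div int a) \<le> t" for t
    proof -
      have "1 \<le> int i + t * int a \<longleftrightarrow> (- t) * int a \<le> int i - 1" by auto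
      also have "\<dots> \<longleftrightarrow> - t \<le> (int i - 1) div int a"
        using assms(1) by (simp only: int_le_div_iff of_nat_0_less_iff)
      finally show ?thesis by auto
    qed
    ultimately have "{t \<in> ?T. t < 0} = {- ((int i - 1) div int a)..<0}" by auto
    moreover have "0 \<le> (int i - 1) div int a" using True assms(1) by (simp add: pos_imp_zdiv_nonneg_iff)
    ultimately show ?thesis by simp
  qed
  have "card ?T = card {t \<in> ?T. t < 0} + 1 + card {t \<in> ?T. 0 < t}"
  proof -
    have fin_sub: "finite {t \<in> ?T. t < 0}" "finite {t \<in> ?T. 0 < t}"
      by (rule finite_subset[OF _ fin], blast)+
    have "?T = ({t \<in> ?T. t < 0} \<union> {0}) \<union> {t \<in> ?T. 0 < t}" using True by auto
    then have "card ?T = card (({t \<in> ?T. t < 0} \<union> {0}) \<union> {t \<in> ?T. 0 < t})" by (rule arg_cong)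
    also have "\<dots> = card ({t \<in> ?T. t < 0} \<union> {0}) + card {t \<in> ?T. 0 < t}"
      by (rule card_Un_disjoint) (use fin_sub in auto)
    also have "card ({t \<in> ?T. t < 0} \<union> {0}) = card {t \<in> ?T. t < 0} + card {0::int}"
      by (rule card_Un_disjoint) (use fin_sub in auto)
    finally show ?thesis by simp
  qed
  moreover have "card (?T - ?M) + card ?M = card ?T"
  proof -
    have "?M \<subseteq> ?T" by (auto simp: missing_def)
    then show ?thesis using card_Diff_subset[of ?M ?T] card_mono[OF fin, of ?M] finite_subset[OF _ fin, of ?M] by simp
  qed
  ultimately have "card {t \<in> ?T. 0 < t} < card (?T - ?M) \<longleftrightarrow> card ?M \<le> card {t \<in> ?T. t < 0}" by linarith
  also have "\<dots> \<longleftrightarrow> int (card ?M) \<le> (int i - 1) div int a" using above by linarith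
  finally show ?thesis
    using True self_in_ladder[of i j a b] below within
    unfolding column_regularization_iff_lowest lowest_def by simp
qed (auto simp: column_regularization_iff_lowest)

section \<open>Regularization preserves the number of boxes\<close>

lemma card_lowest:
  assumes "finite S" "inj_on fst S" "n \<le> card S"
  shows "card (lowest n S) = n"
proof -
  \<comment> \<open>Numbers the points of \<open>S\<close> from the bottom up, so that
    \<open>lowest n S\<close> is the preimage of \<open>{..<n}\<close>.\<close>
  let ?rank = "\<lambda>p. card {q \<in> S. fst p < fst q}"
  have less: "?rank p < ?rank p'" if "p \<in> S" "fst p' < fst p" for p p'
    by (rule psubset_card_mono) (use assms(1) that in auto)
  have inj: "inj_on ?rank S"
  proof (rule inj_onI)
    fix p p'
    assume p: "p \<in> S" "p' \<in> S" "?rank p = ?rank p'"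
    then have "fst p = fst p'" using less[of p p'] less[of p' p]
      by (cases "fst p" "fst p'" rule: linorder_cases) auto
    then show "p = p'" using assms(2) p by (simp add: inj_on_def)
  qed
  have "?rank ` S \<subseteq> {..<card S}"
  proof
    fix m
    assume "m \<in> ?rank ` S"
    then obtain p where "p \<in> S" "m = ?rank p" by blast
    moreover have "{q \<in> S. fst p < fst q} \<subset> S" using \<open>p \<in> S\<close> by auto
    ultimately show "m \<in> {..<card S}" using psubset_card_mono[OF assms(1)] by simp
  qed
  then have image: "?rank ` S = {..<card S}"
    using card_image[OF inj] by (intro card_subset_eq) auto
  have "?rank ` lowest n S = {m \<in> ?rank ` S. m < n}" unfolding lowest_def by blast
  also have "\<dots> = {..<n}" unfolding image using assms(3) by auto
  finally have "?rank ` lowest n S = {..<n}" .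
  moreover have "inj_on ?rank (lowest n S)" by (rule inj_on_subset[OF inj]) (auto simp: lowest_def)
  ultimately show ?thesis using card_image by fastforce
qed

lemma finite_ladder:
  assumes "0 < a" "a < b"
  shows "finite (ladder a b (int i) (int j))"
  unfolding ladder_image by (intro finite_imageI finite_ladder_index assms)

lemma inj_on_fst_ladder:
  assumes "0 < a" "a < b"
  shows "inj_on fst (ladder a b x y)"
  using assms by (auto simp: inj_on_def ladder_def)

text \<open>Boxes are grouped by the ladder through them; corresponding groups of the two sets have
  equal size by \<open>card_lowest\<close>.\<close>

lemma card_column_regularization:
  assumes "0 < a" "a < b" "finite (column_regularization a b \<nu>)"
  shows "card (column_regularization a b \<nu>) = card (young_diagram \<nu>)"
proof -
  let ?key = "\<lambda>(i, j). ladder a b (int i) (int j)"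
  let ?A = "column_regularization a b \<nu>" and ?B = "young_diagram \<nu>"
  have pos: "0 < i \<and> 0 < j" if "(i, j) \<in> ?A \<union> ?B" for i j
    using that by (auto simp: column_regularization_iff_lowest young_diagram_def)
  have key: "?key (i', j') = ?key (i, j) \<longleftrightarrow> (i', j') \<in> ladder a b (int i) (int j)"
    if "0 < i'" "0 < j'" for i j i' j'
    using self_in_ladder[OF that] ladder_eq[of i' j' a b] by auto
  have fib: "card {p \<in> ?A. ?key p = L} = card {p \<in> ?B. ?key p = L}" if L_in: "L \<in> ?key ` (?A \<union> ?B)" for L
  proof -
    obtain p where p: "L = ?key p" using L_in by blast
    obtain i j where "p = (i, j)" by (cases p)
    with p have L: "L = ladder a b (int i) (int j)" by simp
    have B: "{p \<in> ?B. ?key p = L} = ?B \<inter> L"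
    proof (rule set_eqI)
      fix p :: "nat \<times> nat"
      obtain i' j' where p: "p = (i', j')" by (cases p)
      show "p \<in> {p \<in> ?B. ?key p = L} \<longleftrightarrow> p \<in> ?B \<inter> L"
        using key[of i' j' i j] pos[of i' j'] unfolding L p by auto
    qed
    have A: "{p \<in> ?A. ?key p = L} = lowest (card (?B \<inter> L)) L"
    proof (intro set_eqI)
      fix p :: "nat \<times> nat"
      obtain i' j' where p: "p = (i', j')" by force
      show "p \<in> {p \<in> ?A. ?key p = L} \<longleftrightarrow> p \<in> lowest (card (?B \<inter> L)) L"
      proof
        assume "p \<in> {p \<in> ?A. ?key p = L}"
        then show "p \<in> lowest (card (?B \<inter> L)) L" by (auto simp: p column_regularization_iff_lowest)
      next
        assume low: "p \<in> lowest (card (?B \<inter> L)) L"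
        then have "(i', j') \<in> ladder a b (int i) (int j)" by (simp add: p L lowest_def)
        moreover have "0 < i'" "0 < j'" using calculation by (auto simp: ladder_def)
        ultimately show "p \<in> {p \<in> ?A. ?key p = L}"
          using low ladder_eq[of i' j' a b "int i" "int j"] by (simp add: p L column_regularization_iff_lowest)
      qed
    qed
    have "finite L" unfolding L by (rule finite_ladder[OF assms(1,2)])
    moreover have "inj_on fst L" unfolding L by (rule inj_on_fst_ladder[OF assms(1,2)])
    ultimately show ?thesis unfolding A B by (intro card_lowest card_mono) auto
  qed
  have fin: "finite ?B" by (rule finite_young_diagram)
  have "card X = (\<Sum>L\<in>?key ` (?A \<union> ?B). card {p \<in> X. ?key p = L})" if "X \<subseteq> ?A \<union> ?B" for X
  proof -
    have "finite X" using that assms(3) fin finite_subset by blast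
    then have "(\<Sum>L\<in>?key ` (?A \<union> ?B). \<Sum>p\<in>{p \<in> X. ?key p = L}. 1::nat) = (\<Sum>p\<in>X. 1)"
      by (intro sum.group) (use that assms(3) fin in auto)
    then show ?thesis by simp
  qed
  from this[of ?A] this[of ?B] show ?thesis using fib by simp
qed

section \<open>Regularization before and after one application of J\<close>

lemma (in hook_path) uncovered_dvd:
  assumes "s \<notin> covered" "1 \<le> D (s + 1)"
  shows "a dvd D (s + 1)"
  using assms(1)
proof (cases rule: not_covered_cases)
  case 1
  then show ?thesis using assms pos_iff[of s] by simp
next
  case (2 q)
  then show ?thesis using depth_in_gap(1)[OF 2] gap[OF 2] by simp
qed

text \<open>Read through \<open>column_regularization_iff\<close>, the box \<open>(i, j)\<close>
  after \<open>J\<close> corresponds to \<open>(i + 1, j)\<close> before. If \<open>a\<close>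
  divides \<open>i\<close>, the quotient on the right is larger by one, and so is the count, unless
  nothing is missing; otherwise both stay the same.\<close>

lemma missing_after_removal:
  fixes a b :: nat and i j :: int
  assumes "hook_path D (int b) \<sigma> (int a)" "\<And>s. s \<le> D s" "1 \<le> i" "1 \<le> j"
  shows "int (card (missing (greedy_path.E D (int b) \<sigma>) a b i j)) \<le> (i - 1) div int a \<longleftrightarrow>
         int (card (missing D a b (i + 1) j)) \<le> i div int a"
proof -
  interpret hook_path D "int b" \<sigma> "int a" by fact
  have ab: "0 < a" "a < b" using a_pos a_less_b by auto
  define z where "z t = i - j + t * int b" for t
  define M where "M = missing E a b i j"
  \<comment> \<open>\<open>G\<close> and \<open>R\<close> hold the points missing only before
    \<open>J\<close>: those at uncovered positions of exactly this depth, and the one in the first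
    row, which has no counterpart afterwards.\<close>
  define G where "G = {t. 1 \<le> i + t * int a \<and> 1 \<le> j - t * (int b - int a) \<and> D (z t + 1) = i + t * int a \<and> z t \<notin> covered}"
  define R where "R = {t. i + t * int a = 0 \<and> 1 \<le> j - t * (int b - int a) \<and> D (z t + 1) \<le> 0}"
  have split: "missing D a b (i + 1) j = M \<union> G \<union> R"
  proof (rule set_eqI)
    fix t
    have eq: "i + 1 - j + t * int b = z t + 1" by (simp add: z_def)
    have "t \<in> missing D a b (i + 1) j \<longleftrightarrow> 0 \<le> i + t * int a \<and>
        1 \<le> j - t * (int b - int a) \<and> D (z t + 1) \<le> i + t * int a"
      unfolding missing_def mem_Collect_eq eq by auto
    moreover have "t \<in> M \<longleftrightarrow> 1 \<le> i + t * int a \<and> 1 \<le> j - t * (int b - int a) \<and> E (z t) < i + t * int a"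
      by (simp add: M_def missing_def z_def)
    ultimately show "t \<in> missing D a b (i + 1) j \<longleftrightarrow> t \<in> M \<union> G \<union> R"
      by (auto simp: G_def R_def E_def)
  qed
  have fin: "finite M" "finite G" "finite R"
    using finite_missing[OF ab, of D "i + 1" j] unfolding split by auto
  have "M \<inter> G = {}" by (auto simp: M_def missing_def G_def E_def z_def)
  moreover have "(M \<union> G) \<inter> R = {}" by (auto simp: M_def missing_def G_def R_def)
  ultimately have card: "card (missing D a b (i + 1) j) = card M + card G + card R"
    unfolding split using fin by (simp add: card_Un_disjoint)
  show ?thesis
  proof (cases "int a dvd i")
    case False
    have "t \<notin> G" for t
    proof
      assume "t \<in> G"
      then have "int a dvd i + t * int a" using uncovered_dvd[of "z t"] by (auto simp: G_def)
      then show False using False by (simp add: dvd_add_left_iff)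
    qed
    moreover have "t \<notin> R" for t
    proof
      assume "t \<in> R"
      then have "i = (- t) * int a" by (simp add: R_def)
      then show False using False by simp
    qed
    ultimately have "G = {}" "R = {}" by auto
    moreover have "(i - 1) div int a = i div int a"
    proof -
      have "i mod int a \<noteq> 0" using False mod_eq_0_iff_dvd[of i "int a"] by blast
      then have "0 < i mod int a" using pos_mod_sign[OF a_pos, of i] by linarith
      then have "i div int a * int a \<le> i - 1" using div_mult_mod_eq[of i "int a"] by linarith
      then have "i div int a \<le> (i - 1) div int a" using int_le_div_iff[OF a_pos] by blast
      moreover have "(i - 1) div int a \<le> i div int a" using a_pos by (intro zdiv_mono1) auto
      ultimately show ?thesis by simp
    qed
    ultimately show ?thesis using card by (simp add: M_def)
  next
    case True
    then obtain n where n: "i = n * int a" by (metis dvdE mult.commute)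
    have "0 < n" using n assms(3) a_pos by (metis int_one_le_iff_zero_less zero_less_mult_pos2)
    have div: "i div int a = n" "(i - 1) div int a = n - 1"
    proof -
      show "i div int a = n" using n a_pos by simp
      show "(i - 1) div int a = n - 1"
        using int_le_div_iff[OF a_pos, of n "i - 1"] int_le_div_iff[OF a_pos, of "n - 1" "i - 1"] n a_pos
        by (simp add: algebra_simps)
    qed
    \<comment> \<open>The ladder of \<open>(i + 1, j)\<close> meets the first row in the box
      \<open>(1, -w)\<close>, at index \<open>-n\<close>; so \<open>t + n\<close> is the index
      counted from there.\<close>
    define w where "w = i - j - n * int b"
    have z: "z t = w + (t + n) * int b" for t by (simp add: z_def w_def algebra_simps)
    have row: "i + t * int a = (t + n) * int a" for t by (simp add: n algebra_simps)
    have pos: "0 < m" if "1 \<le> m * int a" for m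
      using that a_pos by (metis int_one_le_iff_zero_less zero_less_mult_pos2)
    show ?thesis
    proof (cases "1 \<le> D (w + 1)")
      case False
      have "G = {}"
        using False uncovered_on_ladder_pos[of w] pos unfolding G_def z row by auto
      moreover have "R = {- n}"
      proof -
        have "0 \<le> n * (int b - int a)" using \<open>0 < n\<close> a_less_b by simp
        then show ?thesis using False a_pos assms(4) unfolding R_def z row by auto
      qed
      ultimately have "card (missing D a b (i + 1) j) = card M + 1" using card by simp
      then show ?thesis unfolding div M_def by linarith
    next
      case True
      then have "R = {}" using a_pos unfolding R_def z row by auto
      show ?thesis
      proof (cases "missing D a b (i + 1) j = {}")
        case True
        then have "M = {}" using split by auto
        then show ?thesis using True div \<open>0 < n\<close> by (simp add: M_def)
      next
        case False
        then obtain t where "t \<in> missing D a b (i + 1) j" by blast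
        then have t: "0 \<le> (t + n) * int a" "D (w + (t + n) * int b + 1) \<le> (t + n) * int a"
          unfolding missing_def row[symmetric] z[symmetric] by (auto simp: z_def algebra_simps)
        have "0 \<le> t + n" using t(1) a_pos by (simp add: zero_le_mult_iff)
        then obtain m where m: "0 < m" "w + m * int b \<notin> covered" "D (w + m * int b + 1) = m * int a"
          using uncovered_on_ladder_exists[OF True] t(2) by blast
        have "m - n \<in> G"
        proof -
          \<comment> \<open>Since \<open>s \<le> D s\<close>, the path stays in nonnegative columns,
            which gives the point found by \<open>uncovered_on_ladder_exists\<close> a positive
            column.\<close>
          have "w + m * int b + 1 \<le> m * int a" using assms(2)[of "w + m * int b + 1"] m(3) by simp
          then have "1 \<le> j - (m - n) * (int b - int a)" by (simp add: w_def n algebra_simps)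
          moreover have "1 \<le> m * int a" using m(1) a_pos by (simp add: int_one_le_iff_zero_less)
          ultimately show ?thesis using m unfolding G_def z row by simp
        qed
        moreover have "t = m - n" if "t \<in> G" for t
          using that uncovered_on_ladder_unique[of w "t + n" m] m pos[of "t + n"] unfolding G_def z row by auto
        ultimately have "G = {m - n}" by blast
        then have "card (missing D a b (i + 1) j) = card M + 1" using card \<open>R = {}\<close> by simp
        then show ?thesis unfolding div M_def by linarith
      qed
    qed
  qed
qed

section \<open>Hook lengths and the main induction\<close>

definition hook_bounded :: "nat \<Rightarrow> nat \<Rightarrow> nat list \<Rightarrow> bool" where
  "hook_bounded a b \<nu> \<longleftrightarrow> (\<forall>s m. 0 < m \<longrightarrow> depth \<nu> (s + 1) = depth \<nu> s + 1 \<longrightarrow>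
     depth \<nu> (s + m * int b + 1) = depth \<nu> (s + m * int b) \<longrightarrow>
     int (depth \<nu> (s + m * int b)) \<le> int (depth \<nu> s) + m * int a)"

lemma part_conjugate:
  assumes "is_partition \<nu>" "1 \<le> i" "(i, j) \<in> young_diagram \<nu>" "(i + 1, j) \<notin> young_diagram \<nu>"
  shows "part (conjugate \<nu>) j = i"
proof -
  have j: "1 \<le> j" "j \<le> part \<nu> i" "part \<nu> (i + 1) < j"
    using assms(2-4) by (auto simp: young_diagram_def)
  have "(i', j) \<in> young_diagram \<nu> \<longleftrightarrow> i' \<in> {1..i}" for i'
    using part_antimono[OF assms(1), of i' i] part_antimono[OF assms(1), of "i + 1" i'] j
    by (cases "i' \<le> i") (auto simp: young_diagram_def)
  then have "{i'. (i', j) \<in> young_diagram \<nu>} = {1..i}" by blast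
  moreover have "j \<le> part \<nu> 1" using j part_antimono[OF assms(1), of 1 i] assms(2) by simp
  ultimately show ?thesis using j by (simp add: conjugate_def part_def[of "map _ _"] del: upt_Suc)
qed

text \<open>A south step at \<open>s\<close> and a west step at \<open>s + m b\<close> bound a hook of length \<open>m b\<close>, whose leg
  counts the south steps strictly between them.\<close>

lemma hook_bounded_if_hooks:
  assumes "0 < a" "a < b" "is_partition \<nu>"
    and hooks: "\<And>i j. (i, j) \<in> young_diagram \<nu> \<Longrightarrow> b dvd hook \<nu> i j \<Longrightarrow>
           (real b / real a - 1) * real (leg \<nu> i j) < real (arm \<nu> i j) + 1"
  shows "hook_bounded a b \<nu>"
  unfolding hook_bounded_def
proof (intro allI impI)
  fix s m :: int
  assume m: "0 < m" and south: "depth \<nu> (s + 1) = depth \<nu> s + 1"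
    and flat: "depth \<nu> (s + m * int b + 1) = depth \<nu> (s + m * int b)"
  define s' where "s' = s + m * int b"
  define d where "d = depth \<nu> s"
  define d' where "d' = depth \<nu> s'"
  \<comment> \<open>The corner of the hook: the row of the south step and the column of the west
    step.\<close>
  define i where "i = d + 1"
  define j where "j = nat (int d' - s')"
  have mb: "0 < m * int b" using m assms by simp
  have j1: "s' + 1 \<le> int d'" using depth_ge[OF assms(3), of "s' + 1"] flat by (simp add: d'_def s'_def)
  have "row_end \<nu> i \<le> s + 1" using le_depth_iff[OF assms(3), of i "s + 1"] south by (simp add: i_def d_def)
  moreover have "\<not> row_end \<nu> i \<le> s" using le_depth_iff[OF assms(3), of i s] by (simp add: i_def d_def)
  ultimately have part_i: "int (part \<nu> i) = int d - s" by (simp add: row_end_def i_def)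
  have i_le: "i \<le> d'"
    using depth_mono[OF assms(3), of "s + 1" s'] mb south by (simp add: i_def d_def d'_def s'_def)
  have bottom: "(d', j) \<in> young_diagram \<nu>" "(d' + 1, j) \<notin> young_diagram \<nu>"
    using j1 i_le flat unfolding young_diagram_iff[OF assms(3)]
    by (auto simp: j_def i_def d'_def s'_def algebra_simps)
  have conj: "part (conjugate \<nu>) j = d'"
    by (rule part_conjugate[OF assms(3) _ bottom]) (use i_le i_def in simp)
  then have leg: "leg \<nu> i j = d' - i" by (simp add: leg_def)
  have box: "(i, j) \<in> young_diagram \<nu>"
    using bottom(1) part_antimono[OF assms(3), of i d'] i_le by (auto simp: young_diagram_def i_def)
  have "j \<le> part \<nu> i" using box by (simp add: young_diagram_def)
  then have arm: "int (arm \<nu> i j) = int d - s - (int d' - s')"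
    using part_i j1 by (simp add: arm_def of_nat_diff j_def)
  have "int (hook \<nu> i j) = m * int b"
    using arm leg i_le by (simp add: hook_def of_nat_diff s'_def i_def)
  then have "b dvd hook \<nu> i j" by (metis dvd_triv_right int_dvd_int_iff)
  then have "(real b / real a - 1) * real (leg \<nu> i j) < real (arm \<nu> i j) + 1" using hooks box by blast
  \<comment> \<open>With this value of \<open>arm + 1\<close> the hypothesis becomes
    \<open>leg < m * a\<close>, and \<open>leg + 1\<close> is the rise of the depth.\<close>
  moreover have "real (arm \<nu> i j) + 1 = real_of_int (m * int b) - real (leg \<nu> i j)"
  proof -
    have "int (arm \<nu> i j) + 1 = m * int b - int (leg \<nu> i j)"
      using arm leg i_le by (simp add: of_nat_diff s'_def i_def)
    then show ?thesis by (metis of_int_1 of_int_add of_int_diff of_int_of_nat_eq)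
  qed
  ultimately have "real b / real a * real (leg \<nu> i j) < real_of_int m * real b" by (simp add: algebra_simps)
  then have "real b * real (leg \<nu> i j) < real b * (real_of_int m * real a)"
    using assms(1) by (simp add: field_simps)
  then have "real (leg \<nu> i j) < real_of_int m * real a" using assms(1,2) by simp
  then have "int (leg \<nu> i j) < m * int a" by (metis of_int_less_iff of_int_mult of_int_of_nat_eq)
  then show "int (depth \<nu> (s + m * int b)) \<le> int (depth \<nu> s) + m * int a"
    using leg i_le by (simp add: of_nat_diff i_def d_def d'_def s'_def)
qed

text \<open>A block of \<open>b\<close> equal parts gives \<open>b\<close> consecutive south steps.
  Their run ends with a west step, and \<open>b\<close> steps earlier the path goes south; the depth
  rises by \<open>b > a\<close> in between, contrary to the hook bound for
  \<open>m = 1\<close>.\<close>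

lemma hook_bounded_imp_regular:
  assumes "0 < a" "a < b" "is_partition \<nu>" "hook_bounded a b \<nu>"
  shows "regular b \<nu>"
  unfolding regular_def
proof
  assume "\<exists>i\<ge>1. 0 < part \<nu> i \<and> (\<forall>t<b. part \<nu> (i + t) = part \<nu> i)"
  then obtain i where i: "1 \<le> i" "0 < part \<nu> i" "\<And>t. t < b \<Longrightarrow> part \<nu> (i + t) = part \<nu> i" by blast
  define s where "s = row_end \<nu> i - 1"
  let ?south = "\<lambda>t. depth \<nu> (s + int t + 1) = depth \<nu> (s + int t) + 1"
  have south: "?south t" if "t < b" for t
  proof -
    have "row_end \<nu> (i + t) = s + int t + 1" using i(3)[OF that] by (simp add: s_def row_end_def)
    then show ?thesis using depth_row_end[OF assms(3), of "i + t"] i(1) by (simp add: algebra_simps)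
  qed
  have run: "int (depth \<nu> (s + int t)) = int (depth \<nu> s) + int t" if "\<And>u. u < t \<Longrightarrow> ?south u" for t
    using that
  proof (induction t)
    case (Suc t)
    then show ?case using Suc.prems[of t] Suc.IH by (simp add: algebra_simps)
  qed simp
  have D_s: "int (depth \<nu> s) = int i - 1" using depth_row_end(2)[OF assms(3) i(1)] i(1) by (simp add: s_def)
  have "\<exists>t. \<not> ?south t"
  proof (rule ccontr)
    assume all: "\<not> ?thesis"
    \<comment> \<open>An endless run would reach diagonal \<open>length \<nu> + i\<close>, where the
      depth equals the diagonal. Having started at a positive part, the run would be deeper than
      that.\<close>
    define t where "t = nat (int (length \<nu>) + int i - s)"
    have s_less: "s < int i" by (simp add: s_def row_end_def)
    then have st: "s + int t = int (length \<nu> + i)" by (simp add: t_def)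
    have "\<not> length \<nu> + i + 1 \<le> depth \<nu> (s + int t)"
      unfolding le_depth_iff[OF assms(3)] st using row_end_beyond[of \<nu> "length \<nu> + i + 1"] by simp
    moreover have "int (depth \<nu> (s + int t)) = int i - 1 + int t"
      using run[of t] all D_s by simp
    ultimately show False using st i(2) by (simp add: s_def row_end_def)
  qed
  define n where "n = (LEAST t. \<not> ?south t)"
  have n: "\<not> ?south n" unfolding n_def by (rule LeastI_ex) fact
  have before: "?south t" if "t < n" for t using not_less_Least[of t "\<lambda>t. \<not> ?south t"] that by (simp add: n_def)
  have "b \<le> n" using south n by (meson not_le)
  define z where "z = s + int (n - b)"
  have z: "z + 1 * int b = s + int n" using \<open>b \<le> n\<close> by (simp add: z_def of_nat_diff)
  have "depth \<nu> (z + 1) = depth \<nu> z + 1" using before[of "n - b"] \<open>b \<le> n\<close> assms(1,2) by (simp add: z_def)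
  moreover have "depth \<nu> (z + 1 * int b + 1) = depth \<nu> (z + 1 * int b)"
    unfolding z using depth_step[OF assms(3), of "s + int n"] n by auto
  ultimately have "int (depth \<nu> (z + 1 * int b)) \<le> int (depth \<nu> z) + 1 * int a"
    using assms(4) unfolding hook_bounded_def by (meson zero_less_one)
  moreover have "int (depth \<nu> z) = int (depth \<nu> s) + int (n - b)"
    unfolding z_def using before by (intro run) simp
  moreover have "int (depth \<nu> (z + 1 * int b)) = int (depth \<nu> s) + int n"
    unfolding z using before by (intro run) simp
  ultimately show False using \<open>b \<le> n\<close> assms(2) by (simp add: of_nat_diff)
qed

text \<open>Let \<open>c\<close> be the number of boxes missing from the ladder of the box \<open>(1, -w)\<close>. The regularization
  contains the box of this ladder in row \<open>1 + c a\<close>, hence also its upper neighbour. Its ladder would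
  have \<open>c\<close> missing boxes too if no missing box of the first ladder lay just below a column.\<close>

lemma ladders_if_regularization_partition:
  assumes "0 < a" "a < b" "is_partition \<nu>" "is_partition \<mu>"
    and reg: "young_diagram \<mu> = column_regularization a b \<nu>"
    and pos: "1 \<le> depth \<nu> (w + 1)" and m: "0 \<le> m" and miss: "int (depth \<nu> (w + m * int b + 1)) \<le> m * int a"
  shows "\<exists>n\<ge>0. int (depth \<nu> (w + n * int b)) = n * int a \<and> int (depth \<nu> (w + n * int b + 1)) = n * int a"
proof (rule ccontr)
  assume not: "\<not> ?thesis"
  let ?D = "\<lambda>s. int (depth \<nu> s)"
  let ?c = "int b - int a"
  have c_pos: "0 < ?c" using assms by simp
  have col_m: "m * ?c \<le> - w - 1"
    using depth_ge[OF assms(3), of "w + m * int b + 1"] miss by (simp add: algebra_simps)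
  moreover have "0 \<le> m * ?c" using m c_pos by simp
  ultimately have "w \<le> - 1" by linarith
  define M where "M = {t. 0 \<le> t \<and> t * ?c \<le> - w - 1 \<and> ?D (w + t * int b + 1) \<le> t * int a}"
  define tm where "tm = (- w - 1) div ?c"
  \<comment> \<open>Index 0 is the box \<open>(1, -w)\<close>, which \<open>pos\<close> puts in the
    diagram. So the missing indices lie in \<open>{1..tm}\<close>, and index \<open>card M\<close>
    is still a point of the ladder.\<close>
  have M_sub: "M \<subseteq> {1..tm}"
  proof
    fix t
    assume t: "t \<in> M"
    then have "t \<noteq> 0" using pos by (auto simp: M_def)
    then show "t \<in> {1..tm}" using t int_le_div_iff[OF c_pos, of t "- w - 1"] by (simp add: M_def tm_def)
  qed
  then have fin: "finite M" by (rule finite_subset) simp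
  define n where "n = card M"
  have "m \<in> M" using m miss col_m by (simp add: M_def)
  then have n1: "1 \<le> n" using fin by (auto simp: n_def Suc_le_eq card_gt_0_iff)
  have "int n \<le> tm"
  proof -
    have "n \<le> card {1..tm}" unfolding n_def by (rule card_mono[OF _ M_sub]) simp
    then show ?thesis using n1 by simp
  qed
  then have n_col: "int n * ?c \<le> - w - 1" using int_le_div_iff[OF c_pos] by (simp add: tm_def)
  define j where "j = nat (- w - int n * ?c)"
  have j: "int j = - w - int n * ?c" "1 \<le> j" using n_col by (auto simp: j_def)
  have shift: "card {t. t + int n \<in> M} = n"
  proof -
    have "{t. t + int n \<in> M} = (\<lambda>t. t - int n) ` M"
      by (force intro: image_eqI[of _ _ "_ + int n"])
    then show ?thesis by (simp add: card_image inj_on_def n_def)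
  qed
  have a_pos: "0 < int a" using assms by simp
  have nonneg_iff: "1 \<le> 1 + x * int a \<longleftrightarrow> 0 \<le> x" for x using a_pos by (simp add: zero_le_mult_iff)
  have row1: "int (1 + n * a) + t * int a = 1 + (t + int n) * int a" for t by (simp add: algebra_simps)
  have row0: "int (n * a) + t * int a = (t + int n) * int a" for t by (simp add: algebra_simps)
  have col: "int j - t * ?c = - w - (t + int n) * ?c" for t by (simp add: j algebra_simps)
  have diag1: "int (1 + n * a) - int j + t * int b = w + (t + int n) * int b + 1" for t
    by (simp add: j algebra_simps)
  have diag0: "int (n * a) - int j + t * int b = w + (t + int n) * int b" for t
    by (simp add: j algebra_simps)
  have "missing ?D a b (int (1 + n * a)) (int j) = {t. t + int n \<in> M}"
    unfolding missing_def row1 col diag1 nonneg_iff M_def by auto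
  then have "(1 + n * a, j) \<in> column_regularization a b \<nu>"
    using column_regularization_iff[OF assms(1-3), of "1 + n * a" j] shift j(2) assms(1) by simp
  then have "(n * a, j) \<in> column_regularization a b \<nu>"
    using reg[symmetric] part_antimono[OF assms(4), of "n * a" "1 + n * a"] n1 assms(1)
    by (auto simp: young_diagram_def Suc_le_eq)
  then have "int (card (missing ?D a b (int (n * a)) (int j))) \<le> (int (n * a) - 1) div int a"
    using column_regularization_iff[OF assms(1-3)] by blast
  moreover have "\<not> int n \<le> (int (n * a) - 1) div int a"
    unfolding int_le_div_iff[OF a_pos] by simp
  moreover have "n \<le> card (missing ?D a b (int (n * a)) (int j))"
  proof -
    have "{t. t + int n \<in> M} \<subseteq> missing ?D a b (int (n * a)) (int j)"
    proof
      fix t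
      assume "t \<in> {t. t + int n \<in> M}"
      then have tM: "t + int n \<in> M" by simp
      define u where "u = t + int n"
      have u: "1 \<le> u" "u * ?c \<le> - w - 1" "?D (w + u * int b + 1) \<le> u * int a"
        using tM M_sub by (auto simp: u_def M_def)
      have "?D (w + u * int b) \<le> ?D (w + u * int b + 1)" using depth_mono[OF assms(3)] by simp
      \<comment> \<open>By \<open>not\<close>, the point just above a missing one is missing too.
        All \<open>n\<close> indices thus carry over to the ladder of \<open>(n * a, j)\<close>,
        which tolerates only \<open>n - 1\<close>.\<close>
      moreover have "\<not> (?D (w + u * int b) = u * int a \<and> ?D (w + u * int b + 1) = u * int a)"
        using not u(1) by auto
      ultimately have "?D (w + u * int b) < u * int a" using u(3) by linarith
      moreover have "1 \<le> u * int a" using u(1) a_pos by (simp add: int_one_le_iff_zero_less)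
      ultimately show "t \<in> missing ?D a b (int (n * a)) (int j)"
        unfolding missing_def mem_Collect_eq row0 col diag0 u_def[symmetric] using u by simp
    qed
    then have "card {t. t + int n \<in> M} \<le> card (missing ?D a b (int (n * a)) (int j))"
      by (rule card_mono[OF finite_missing[OF assms(1,2)]])
    then show ?thesis using shift by simp
  qed
  ultimately show False by linarith
qed

text \<open>One round of the induction: that the regularization is a partition supplies the
  assumption \<open>ladders\<close> of \<open>hook_path\<close>; in return \<open>J\<close>
  preserves the hook bound and deletes the first row of the regularization.\<close>

lemma J_map_regularization:
  assumes "0 < a" "a < b" "is_partition \<nu>" "hook_bounded a b \<nu>" "\<nu> \<noteq> []" "is_partition \<mu>"
    and reg: "young_diagram \<mu> = column_regularization a b \<nu>"
  shows "is_partition (J_map b \<nu>)" and "hook_bounded a b (J_map b \<nu>)"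
    and "1 \<le> i \<Longrightarrow> (i, j) \<in> column_regularization a b (J_map b \<nu>) \<longleftrightarrow>
           (i + 1, j) \<in> column_regularization a b \<nu>"
proof -
  let ?D = "\<lambda>s. int (depth \<nu> s)" and ?\<sigma> = "piece_start b \<nu>"
  interpret rim_removal b \<nu> by unfold_locales (use assms in auto)
  have path: "hook_path ?D (int b) ?\<sigma> (int a)"
  proof
    fix s m :: int
    assume "0 < m" "?D (s + 1) = ?D s + 1" "?D (s + m * int b + 1) = ?D (s + m * int b)"
    then show "?D (s + m * int b) \<le> ?D s + m * int a"
      using assms(4) unfolding hook_bounded_def by auto
  next
    fix w m :: int
    assume "1 \<le> ?D (w + 1)" "0 \<le> m" "?D (w + m * int b + 1) \<le> m * int a"
    then show "\<exists>n\<ge>0. ?D (w + n * int b) = n * int a \<and> ?D (w + n * int b + 1) = n * int a"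
      by (intro ladders_if_regularization_partition[OF assms(1-3,6) reg]) auto
  qed (use assms in auto)
  show J: "is_partition (J_map b \<nu>)" using J_map_boundary by simp
  have D_J: "(\<lambda>s. int (depth (J_map b \<nu>) s)) = E" using J_map_boundary by auto
  then have D_J': "int (depth (J_map b \<nu>) s) = E s" for s by metis
  show "hook_bounded a b (J_map b \<nu>)"
    unfolding hook_bounded_def
  proof (intro allI impI)
    fix s m :: int
    assume m: "0 < m" "depth (J_map b \<nu>) (s + 1) = depth (J_map b \<nu>) s + 1"
      "depth (J_map b \<nu>) (s + m * int b + 1) = depth (J_map b \<nu>) (s + m * int b)"
    have "E (s + 1) = E s + 1" "E (s + m * int b + 1) = E (s + m * int b)"
      unfolding D_J'[symmetric] using m by simp_all
    then show "int (depth (J_map b \<nu>) (s + m * int b)) \<le> int (depth (J_map b \<nu>) s) + m * int a"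
      unfolding D_J' by (rule hook_path.E_hooks[OF path m(1)])
  qed
  show "(i, j) \<in> column_regularization a b (J_map b \<nu>) \<longleftrightarrow> (i + 1, j) \<in> column_regularization a b \<nu>"
    if "1 \<le> i"
  proof (cases "1 \<le> j")
    case True
    have "int (card (missing E a b (int i) (int j))) \<le> (int i - 1) div int a \<longleftrightarrow>
        int (card (missing ?D a b (int i + 1) (int j))) \<le> int i div int a"
      by (rule missing_after_removal[OF path]) (use depth_ge[OF assms(3)] that True in auto)
    then show ?thesis
      using that True
      unfolding column_regularization_iff[OF assms(1,2) J] column_regularization_iff[OF assms(1-3)] D_J
      by (simp add: add.commute)
  qed (auto simp: column_regularization_iff_lowest)
qed

text \<open>The first entry splits off by shifting the \<open>LEAST\<close> in the definition, which
  has a witness because the iteration reaches the empty partition.\<close>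

lemma mullineux_transpose_Cons:
  assumes "(J_map b ^^ l) (J_map b \<nu>) = []" "\<nu> \<noteq> []"
  shows "mullineux_transpose b \<nu> = (sum_list \<nu> - sum_list (J_map b \<nu>)) # mullineux_transpose b (J_map b \<nu>)"
proof -
  let ?P = "\<lambda>l. (J_map b ^^ l) \<nu> = []"
  have shift: "(J_map b ^^ Suc i) \<nu> = (J_map b ^^ i) (J_map b \<nu>)" for i
    by (simp add: funpow_swap1)
  have "(LEAST l. ?P l) = Suc (LEAST l. ?P (Suc l))"
    by (rule Least_Suc[of _ "Suc l"]) (use assms shift in auto)
  then have "(LEAST l. ?P l) = Suc (LEAST l. (J_map b ^^ l) (J_map b \<nu>) = [])" by (simp only: shift)
  then show ?thesis
    unfolding mullineux_transpose_def
    by (simp only: upt_conv_Cons[OF zero_less_Suc] map_Suc_upt[symmetric] list.map map_map o_def shift) simp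
qed

text \<open>Induction on the rows of \<open>\<mu>\<close>, with \<open>\<nu>\<close> replaced by
  \<open>J_map b \<nu>\<close>. As regularization preserves the number of boxes, the first entry,
  the loss of boxes under \<open>J\<close>, is the first row of \<open>\<mu>\<close>.\<close>

lemma mullineux_transpose_eq:
  assumes "0 < a" "a < b" "is_partition \<nu>" "hook_bounded a b \<nu>" "is_partition \<mu>"
    and "young_diagram \<mu> = column_regularization a b \<nu>"
  shows "(J_map b ^^ length \<mu>) \<nu> = [] \<and> mullineux_transpose b \<nu> = \<mu>"
  using assms(3-)
proof (induction \<mu> arbitrary: \<nu>)
  case Nil
  have "card (young_diagram \<nu>) = card (column_regularization a b \<nu>)"
    by (rule card_column_regularization[OF assms(1,2), symmetric])
      (metis Nil.prems(4) finite_young_diagram)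
  then have "sum_list \<nu> = sum_list ([] :: nat list)"
    unfolding Nil.prems(4)[symmetric] by (simp only: sum_list_eq_card)
  then have "\<nu> = []" using Nil.prems(1) by (cases \<nu>) (auto simp: is_partition_def)
  moreover have "(LEAST l. (J_map b ^^ l) [] = []) = 0" by (rule Least_eq_0) simp
  ultimately show ?case by (simp add: mullineux_transpose_def)
next
  case (Cons c \<mu>)
  let ?J = "J_map b \<nu>"
  have size: "sum_list \<xi> = sum_list \<rho>" if "young_diagram \<rho> = column_regularization a b \<xi>" for \<xi> \<rho>
    using card_column_regularization[OF assms(1,2), of \<xi>] finite_young_diagram[of \<rho>] that
    by (simp add: sum_list_eq_card)
  have "0 < c" using Cons.prems(3) by (simp add: is_partition_def)
  then have ne: "\<nu> \<noteq> []" using size[OF Cons.prems(4)] by auto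
  note J = J_map_regularization[OF assms(1,2) Cons.prems(1,2) ne Cons.prems(3,4)]
  have \<mu>: "is_partition \<mu>" using Cons.prems(3) by (simp add: is_partition_def)
  have "young_diagram \<mu> = column_regularization a b ?J"
  proof (rule set_eqI)
    fix p :: "nat \<times> nat"
    obtain i j where p: "p = (i, j)" by (cases p)
    show "p \<in> young_diagram \<mu> \<longleftrightarrow> p \<in> column_regularization a b ?J"
    proof (cases "1 \<le> i")
      case True
      have "part (c # \<mu>) (i + 1) = part \<mu> i" using True by (simp add: part_def)
      then have "(i, j) \<in> young_diagram \<mu> \<longleftrightarrow> (i + 1, j) \<in> young_diagram (c # \<mu>)"
        using True by (simp add: young_diagram_def)
      then show ?thesis using J(3)[OF True] Cons.prems(4) p by simp
    qed (auto simp: p young_diagram_def column_regularization_iff_lowest)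
  qed
  note IH = Cons.IH[OF J(1,2) \<mu> this] and size_J = size[OF this]
  have "(J_map b ^^ length (c # \<mu>)) \<nu> = []" using IH by (simp add: funpow_swap1)
  moreover have "mullineux_transpose b \<nu> = c # \<mu>"
    using mullineux_transpose_Cons[of "length \<mu>" b \<nu>] IH ne size[OF Cons.prems(4)] size_J by simp
  ultimately show ?case by blast
qed

theorem theorem1p2:
  fixes a b :: nat and \<nu> :: "nat list"
  assumes "0 < a" and "a < b"
    and "is_partition \<nu>"
    and "\<exists>\<mu>. is_partition \<mu> \<and> young_diagram \<mu> = column_regularization a b \<nu>"
    and "\<And>i j. (i, j) \<in> young_diagram \<nu> \<Longrightarrow> b dvd hook \<nu> i j \<Longrightarrow>
           (real b / real a - 1) * real (leg \<nu> i j) < real (arm \<nu> i j) + 1"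
  shows "regular b \<nu> \<and> is_partition (mullineux_transpose b \<nu>) \<and>
         young_diagram (mullineux_transpose b \<nu>) = column_regularization a b \<nu>"
proof -
  have bounded: "hook_bounded a b \<nu>" by (rule hook_bounded_if_hooks[OF assms(1-3,5)])
  obtain \<mu> where \<mu>: "is_partition \<mu>" "young_diagram \<mu> = column_regularization a b \<nu>" using assms(4) by blast
  have "mullineux_transpose b \<nu> = \<mu>" using mullineux_transpose_eq[OF assms(1-3) bounded \<mu>] by blast
  then show ?thesis using hook_bounded_imp_regular[OF assms(1-3) bounded] \<mu> by simp
qed

end
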